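(* Let $\nu$ be a Borel probability measure on $\mathbb{R}^d$ whose support lies in the interior of $[0,1]^d$, and assume that there are $a>0$ and $C\ge 1$ with $\nu(Q)\le C2^{-ak}$ for all $Q\in\mathcal D_k$, $k\ge 0$. Then $$\underline{D}_{0}(\nu)=\liminf_{t\downarrow0}\frac{\log(1/t)}{\mathcal{L}_{\nu}(t)},\qquad\overline{D}_{0}(\nu)=\limsup_{t\downarrow0}\frac{\log(1/t)}{\mathcal{L}_{\nu}(t)}.$$ Both values lie in the interval $J_\nu=[\sigma_-,\sigma_+]$. In both formulas one may replace $t\downarrow0$ by $t=N^{-c}$, $N\to\infty$, for any fixed $c>0$.
   Context: $\log$ is the logarithm to base 2 and $\ln$ the natural logarithm; $\mathbb{R}^d$ carries the maximum norm. $\mathcal D_k$ is the partition of the root cube $[0,1]^d$ into $2^{dk}$ dyadic cubes of side length $2^{-k}$ (half-open cubes, with the outer boundary faces of $[0,1]^d$ assigned to the adjacent end cubes, so that the partitions are disjoint and nested, $\mathcal D_0=\{[0,1]^d\}$); $\mathcal D=\bigcup_{k\ge0}\mathcal D_k$. For $Q\in\mathcal D_k$ put $\ell(Q)=2^{-k}$, and let $Q^-\in\mathcal D_{k-1}$ be the immediate dyadic parent ($k\ge1$). Quantization: for $N\ge1$, $$\mathfrak e_{N,0}(\nu)=\inf_{1\le\#A\le N}\exp\Bigl(\int\ln d(x,A)\,d\nu(x)\Bigr),$$ the infimum over non-empty finite $A\subset\mathbb{R}^d$, $d(x,A)=\inf_{y\in A}\|x-y\|_\infty$, and $$\underline D_0(\nu)=\liminf_{N\to\infty}\frac{\log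 N}{-\log\mathfrak e_{N,0}(\nu)},\qquad \overline D_0(\nu)=\limsup_{N\to\infty}\frac{\log N}{-\log\mathfrak e_{N,0}(\nu)}.$$ Stopping partition: for $0<t<1$, $$P_\nu(t)=\{Q\in\mathcal D\setminus\mathcal D_0:\ 0<\nu(Q)<t\le\nu(Q^-)\},\qquad \mathcal L_\nu(t)=-\sum_{Q\in P_\nu(t)}\nu(Q)\log\ell(Q).$$ Spectrum: $\beta_k(q)=\frac1k\log\sum_{Q\in\mathcal D_k,\nu(Q)>0}\nu(Q)^q$ for $q\in\mathbb{R}$, $k\geq 1$, and $\overline\beta(q)=\limsup_{k\to\infty}\beta_k(q)$, which is finite and convex on $(0,\infty)$. With one-sided derivatives at $1$, $\sigma_-=-\overline\beta'_+(1)$ and $\sigma_+=-\overline\beta'_-(1)$. *)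

theory Defs
  imports "HOL-Probability.Probability"
begin

text \<open>
  The space \<open>\<real>\<^sup>d\<close> is \<open>real^'n\<close> with \<open>d = CARD('n) \<ge> 1\<close>; the maximum norm is
  \<^const>\<open>infnorm\<close>.
\<close>

definition msupport :: "'a::topological_space measure \<Rightarrow> 'a set" where
  "msupport \<nu> = {x. \<forall>U. open U \<and> x \<in> U \<longrightarrow> 0 < emeasure \<nu> U}"


subsection \<open>Dyadic cubes\<close>

text \<open>
  The cube of level \<open>k\<close> with index \<open>z\<close>, where \<open>z $ i < 2 ^ k\<close>, is half-open, except that
  the faces \<open>x $ i = 1\<close> of the root cube belong to the last cube in direction \<open>i\<close>.
\<close>

definition dyadic_cube :: "nat \<Rightarrow> nat^'n \<Rightarrow> (real^'n) set" where
  "dyadic_cube k z = {x. \<forall>i. real (z $ i) / 2 ^ k \<le> x $ i \<and>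
     (x $ i < (real (z $ i) + 1) / 2 ^ k \<or> (z $ i + 1 = 2 ^ k \<and> x $ i = 1))}"

definition dyadic_cubes :: "nat \<Rightarrow> (real^'n) set set" where
  "dyadic_cubes k = {dyadic_cube k z |z. \<forall>i. z $ i < 2 ^ k}"

definition all_dyadic_cubes :: "(real^'n) set set" where
  "all_dyadic_cubes = (\<Union>k. dyadic_cubes k)"

text \<open>
  Cubes of different levels have different side lengths, so the level is determined by the
  cube as a set, and by nestedness the parent is the unique cube of the previous level
  containing it. The parent is only meaningful for levels \<open>k \<ge> 1\<close>.
\<close>

definition dyadic_level :: "(real^'n) set \<Rightarrow> nat" where
  "dyadic_level Q = (THE k. Q \<in> dyadic_cubes k)"

definition side_length :: "(real^'n) set \<Rightarrow> real" where
  "side_length Q = 2 powr (- real (dyadic_level Q))"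

definition dyadic_parent :: "(real^'n) set \<Rightarrow> (real^'n) set" where
  "dyadic_parent Q = (THE R. R \<in> dyadic_cubes (dyadic_level Q - 1) \<and> Q \<subseteq> R)"


subsection \<open>Geometric mean quantization error and quantization dimensions\<close>

definition max_setdist :: "real^'n \<Rightarrow> (real^'n) set \<Rightarrow> real" where
  "max_setdist x A = (INF y\<in>A. infnorm (x - y))"

text \<open>
  The Bochner integral and the convention \<open>ln 0 = 0\<close> are harmless for compactly supported
  \<open>\<nu>\<close> with \<open>\<nu>(Q) \<le> C 2\<^sup>-\<^sup>a\<^sup>k\<close> on the dyadic cubes of level \<open>k\<close> for some \<open>a > 0\<close>: such \<open>\<nu>\<close>
  has no atoms, so the finite set \<open>A\<close> is null, and the logarithmic distance to \<open>A\<close> is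
  integrable.
\<close>

definition quant_error0 :: "(real^'n) measure \<Rightarrow> nat \<Rightarrow> real" where
  "quant_error0 \<nu> N =
     (INF A\<in>{A. finite A \<and> 1 \<le> card A \<and> card A \<le> N}. exp (\<integral>x. ln (max_setdist x A) \<partial>\<nu>))"

definition lower_quant_dim0 :: "(real^'n) measure \<Rightarrow> ereal" where
  "lower_quant_dim0 \<nu> = liminf (\<lambda>N. ereal (log 2 (real N) / - log 2 (quant_error0 \<nu> N)))"

definition upper_quant_dim0 :: "(real^'n) measure \<Rightarrow> ereal" where
  "upper_quant_dim0 \<nu> = limsup (\<lambda>N. ereal (log 2 (real N) / - log 2 (quant_error0 \<nu> N)))"


subsection \<open>Stopping partition\<close>

definition stopping_partition :: "(real^'n) measure \<Rightarrow> real \<Rightarrow> (real^'n) set set" where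
  "stopping_partition \<nu> t = {Q \<in> all_dyadic_cubes - dyadic_cubes 0.
     0 < measure \<nu> Q \<and> measure \<nu> Q < t \<and> t \<le> measure \<nu> (dyadic_parent Q)}"

text \<open>
  For \<open>t > 0\<close> the stopping partition is finite as soon as the maximal mass of the cubes of
  level \<open>k\<close> tends to \<open>0\<close> as \<open>k \<rightarrow> \<infinity>\<close>, so the finite sum is the intended one.
\<close>

definition stopping_length :: "(real^'n) measure \<Rightarrow> real \<Rightarrow> real" where
  "stopping_length \<nu> t =
     - (\<Sum>Q\<in>stopping_partition \<nu> t. measure \<nu> Q * log 2 (side_length Q))"


subsection \<open>Spectrum\<close>

definition spectrum_at :: "(real^'n) measure \<Rightarrow> nat \<Rightarrow> real \<Rightarrow> real" where
  "spectrum_at \<nu> k q =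
     1 / real k * log 2 (\<Sum>Q\<in>{Q \<in> dyadic_cubes k. 0 < measure \<nu> Q}. measure \<nu> Q powr q)"

definition upper_spectrum :: "(real^'n) measure \<Rightarrow> real \<Rightarrow> ereal" where
  "upper_spectrum \<nu> q = limsup (\<lambda>k. ereal (spectrum_at \<nu> k q))"

text \<open>
  For a probability measure carried by the unit cube \<open>upper_spectrum \<nu>\<close> is finite and convex
  on \<open>(0,\<infinity>)\<close>, so the one-sided derivatives at \<open>1\<close> exist. The lower value \<open>\<sigma>\<^sub>-\<close> comes
  from the right derivative, the upper value \<open>\<sigma>\<^sub>+\<close> from the left one.
\<close>

definition sigma_minus :: "(real^'n) measure \<Rightarrow> real" where
  "sigma_minus \<nu> = - vector_derivative (\<lambda>q. real_of_ereal (upper_spectrum \<nu> q)) (at_right 1)"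

definition sigma_plus :: "(real^'n) measure \<Rightarrow> real" where
  "sigma_plus \<nu> = - vector_derivative (\<lambda>q. real_of_ereal (upper_spectrum \<nu> q)) (at_left 1)"

end

theory Submission
  imports Defs "HOL-Real_Asymp.Real_Asymp"
begin

text \<open>
  Let \<open>S\<^sub>k(t)\<close> be the total mass of the cubes of level \<open>k\<close> with mass at least \<open>t\<close> (the heavy
  ones). Abel summation gives \<open>L(t) = \<Sum>\<^sub>k S\<^sub>k(t)\<close> for the stopping length, while
  \<open>- log d(x, A)\<close> is, up to an error of at most one, the number of \<open>k\<close> with
  \<open>d(x, A) < 2\<^sup>-\<^sup>k\<close>. Taking for \<open>A\<close> the corners of all heavy cubes shows
  \<open>- log e\<^sub>N \<ge> L(t) - 1\<close> as soon as \<open>N \<ge> K / t\<close>, where \<open>K = O(log (1/t))\<close> bounds the levels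
  of heavy cubes. Conversely, the \<open>2\<^sup>-\<^sup>k\<close>-neighbourhood of \<open>N\<close> points meets at most \<open>5\<^sup>d N\<close>
  cubes of level \<open>k\<close>, so its mass is at most \<open>S\<^sub>k(t) + 5\<^sup>d N min(t, C 2\<^sup>-\<^sup>a\<^sup>k)\<close>, which
  yields \<open>- log e\<^sub>N \<le> L(t) + O(1)\<close> for \<open>t = N\<^sup>-\<^sup>\<theta>\<close> with any \<open>\<theta> > 1\<close>. As \<open>\<theta>\<close> can be taken
  arbitrarily close to \<open>1\<close> and \<open>L\<close> is monotone and unbounded, the limits agree. For the
  spectrum, Chebyshev's inequality bounds \<open>S\<^sub>k(t)\<close> by \<open>t\<^sup>1\<^sup>-\<^sup>q \<Sum> \<nu>(Q)\<^sup>q\<close> for \<open>q > 1\<close> and \<open>1 - S\<^sub>k(t)\<close>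
  by the same expression for \<open>q < 1\<close>; summing over \<open>k\<close> and letting \<open>q\<close> tend to \<open>1\<close> compares
  \<open>L(t)\<close> with \<open>log (1/t) / \<sigma>\<close> for \<open>\<sigma>\<close> near \<open>\<sigma>\<^sub>-\<close> and \<open>\<sigma>\<^sub>+\<close>.
\<close>

subsection \<open>Upper and lower limits up to factors near one\<close>

text \<open>For finite \<open>y\<close> a factor close to 1 costs arbitrarily little;
  \<open>0 \<le> y\<close> excludes \<open>- \<infinity>\<close>, and the value
  \<open>\<infinity>\<close> is trivial.\<close>

lemma ereal_le_of_le_mult:
  fixes x y :: ereal
  assumes "0 \<le> y" and "\<And>\<kappa>::real. \<kappa> > 1 \<Longrightarrow> x \<le> ereal \<kappa> * y"
  shows "x \<le> y"
proof (cases y)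
  case (real r)
  with assms(1) have "r \<ge> 0" by simp
  show ?thesis
  proof (rule ereal_le_epsilon2)
    fix e :: real assume "e > 0"
    \<comment> \<open>The excess \<open>e * r / (r + 1)\<close> is at most \<open>e\<close>, and the
      summand 1 keeps the denominator positive when \<open>r = 0\<close>.\<close>
    define l where "l = 1 + e / (r + 1)"
    have "l > 1" using \<open>e > 0\<close> \<open>r \<ge> 0\<close> by (simp add: l_def)
    have "l * r \<le> r + e"
      using \<open>e > 0\<close> \<open>r \<ge> 0\<close> by (simp add: l_def field_simps)
    have "x \<le> ereal l * y" by (rule assms(2)) fact
    also have "\<dots> \<le> y + ereal e" using \<open>l * r \<le> r + e\<close> real by simp
    finally show "x \<le> y + ereal e" .
  qed
next
  case MInf then show ?thesis using assms(1) by simp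
qed simp

text \<open>The comparison function \<open>v\<close> may change with \<open>\<kappa>\<close>; only
  the bound \<open>y\<close> on its limit is common. Later \<open>v\<close> is
  \<open>dim_ratio\<close> along \<open>real N powr - \<theta>\<close> with \<open>\<theta>\<close>
  depending on \<open>\<kappa>\<close>.\<close>

lemma Limsup_le_approx:
  fixes u :: "'a \<Rightarrow> real" and y :: ereal
  assumes "F \<noteq> bot" "0 \<le> y"
    and "\<And>\<kappa>. \<kappa> > 1 \<Longrightarrow> \<exists>v. Limsup F (\<lambda>x. ereal (v x)) \<le> y \<and> (\<forall>\<^sub>F x in F. u x \<le> \<kappa> * v x)"
  shows "Limsup F (\<lambda>x. ereal (u x)) \<le> y"
proof (rule ereal_le_of_le_mult[OF assms(2)])
  fix \<kappa> :: real assume l: "\<kappa> > 1"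
  from assms(3)[OF l] obtain v where v: "Limsup F (\<lambda>x. ereal (v x)) \<le> y"
    "\<forall>\<^sub>F x in F. u x \<le> \<kappa> * v x" by blast
  have "Limsup F (\<lambda>x. ereal (u x)) \<le> Limsup F (\<lambda>x. ereal \<kappa> * ereal (v x))"
    by (rule Limsup_mono) (use v(2) in \<open>auto elim!: eventually_mono\<close>)
  also have "\<dots> = ereal \<kappa> * Limsup F (\<lambda>x. ereal (v x))"
    by (rule Limsup_ereal_mult_left) (use assms(1) l in auto)
  also have "\<dots> \<le> ereal \<kappa> * y" using v(1) l by (intro ereal_mult_left_mono) auto
  finally show "Limsup F (\<lambda>x. ereal (u x)) \<le> ereal \<kappa> * y" .
qed

lemma Liminf_le_approx:
  fixes u :: "'a \<Rightarrow> real" and y :: ereal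
  assumes "F \<noteq> bot" "0 \<le> y"
    and "\<And>\<kappa>. \<kappa> > 1 \<Longrightarrow> \<exists>v. Liminf F (\<lambda>x. ereal (v x)) \<le> y \<and> (\<forall>\<^sub>F x in F. u x \<le> \<kappa> * v x)"
  shows "Liminf F (\<lambda>x. ereal (u x)) \<le> y"
proof (rule ereal_le_of_le_mult[OF assms(2)])
  fix \<kappa> :: real assume l: "\<kappa> > 1"
  from assms(3)[OF l] obtain v where v: "Liminf F (\<lambda>x. ereal (v x)) \<le> y"
    "\<forall>\<^sub>F x in F. u x \<le> \<kappa> * v x" by blast
  have "Liminf F (\<lambda>x. ereal (u x)) \<le> Liminf F (\<lambda>x. ereal \<kappa> * ereal (v x))"
    by (rule Liminf_mono) (use v(2) in \<open>auto elim!: eventually_mono\<close>)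
  also have "\<dots> = ereal \<kappa> * Liminf F (\<lambda>x. ereal (v x))"
    by (rule Liminf_ereal_mult_left) (use assms(1) l in auto)
  also have "\<dots> \<le> ereal \<kappa> * y" using v(1) l by (intro ereal_mult_left_mono) auto
  finally show "Liminf F (\<lambda>x. ereal (u x)) \<le> ereal \<kappa> * y" .
qed

text \<open>Here the limit of \<open>u\<close> is the side multiplied by \<open>\<kappa>\<close>, so
  it is \<open>u\<close> that has to be nonnegative for the factor to be removed.\<close>

lemma le_Limsup_approx:
  fixes u :: "'a \<Rightarrow> real" and y :: ereal
  assumes "F \<noteq> bot" "\<forall>\<^sub>F x in F. 0 \<le> u x"
    and "\<And>\<kappa>. \<kappa> > 1 \<Longrightarrow> \<exists>v. y \<le> Limsup F (\<lambda>x. ereal (v x)) \<and> (\<forall>\<^sub>F x in F. v x \<le> \<kappa> * u x)"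
  shows "y \<le> Limsup F (\<lambda>x. ereal (u x))"
proof (rule ereal_le_of_le_mult)
  show "0 \<le> Limsup F (\<lambda>x. ereal (u x))"
    using assms(1,2) by (intro le_Limsup) (auto elim!: eventually_mono)
  fix \<kappa> :: real assume l: "\<kappa> > 1"
  from assms(3)[OF l] obtain v where v: "y \<le> Limsup F (\<lambda>x. ereal (v x))"
    "\<forall>\<^sub>F x in F. v x \<le> \<kappa> * u x" by blast
  note v(1)
  also have "Limsup F (\<lambda>x. ereal (v x)) \<le> Limsup F (\<lambda>x. ereal \<kappa> * ereal (u x))"
    by (rule Limsup_mono) (use v(2) in \<open>auto elim!: eventually_mono\<close>)
  also have "\<dots> = ereal \<kappa> * Limsup F (\<lambda>x. ereal (u x))"
    by (rule Limsup_ereal_mult_left) (use assms(1) l in auto)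
  finally show "y \<le> ereal \<kappa> * Limsup F (\<lambda>x. ereal (u x))" .
qed

lemma le_Liminf_approx:
  fixes u :: "'a \<Rightarrow> real" and y :: ereal
  assumes "F \<noteq> bot" "\<forall>\<^sub>F x in F. 0 \<le> u x"
    and "\<And>\<kappa>. \<kappa> > 1 \<Longrightarrow> \<exists>v. y \<le> Liminf F (\<lambda>x. ereal (v x)) \<and> (\<forall>\<^sub>F x in F. v x \<le> \<kappa> * u x)"
  shows "y \<le> Liminf F (\<lambda>x. ereal (u x))"
proof (rule ereal_le_of_le_mult)
  show "0 \<le> Liminf F (\<lambda>x. ereal (u x))"
    using assms(2) by (intro Liminf_bounded) (auto elim!: eventually_mono)
  fix \<kappa> :: real assume l: "\<kappa> > 1"
  from assms(3)[OF l] obtain v where v: "y \<le> Liminf F (\<lambda>x. ereal (v x))"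
    "\<forall>\<^sub>F x in F. v x \<le> \<kappa> * u x" by blast
  note v(1)
  also have "Liminf F (\<lambda>x. ereal (v x)) \<le> Liminf F (\<lambda>x. ereal \<kappa> * ereal (u x))"
    by (rule Liminf_mono) (use v(2) in \<open>auto elim!: eventually_mono\<close>)
  also have "\<dots> = ereal \<kappa> * Liminf F (\<lambda>x. ereal (u x))"
    by (rule Liminf_ereal_mult_left) (use assms(1) l in auto)
  finally show "y \<le> ereal \<kappa> * Liminf F (\<lambda>x. ereal (u x))" .
qed

text \<open>Substituting \<open>f\<close> passes to a finer filter: whatever holds eventually along
  \<open>G\<close> holds eventually along \<open>F\<close> after \<open>f\<close>, so the lower
  limit can only rise.\<close>

lemma Liminf_filterlim_le:
  fixes g :: "'b \<Rightarrow> 'c::complete_lattice"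
  assumes "filterlim f G F"
  shows "Liminf G g \<le> Liminf F (\<lambda>x. g (f x))"
proof -
  have "Liminf G g \<le> Liminf (filtermap f F) g"
    unfolding Liminf_def using assms by (intro SUP_subset_mono) (auto simp: filterlim_def le_filter_def)
  also have "\<dots> \<le> Liminf F (\<lambda>x. g (f x))" by (rule Liminf_filtermap_le)
  finally show ?thesis .
qed

lemma Limsup_filterlim_ge:
  fixes g :: "'b \<Rightarrow> 'c::complete_lattice"
  assumes "filterlim f G F"
  shows "Limsup F (\<lambda>x. g (f x)) \<le> Limsup G g"
proof -
  have "Limsup F (\<lambda>x. g (f x)) \<le> Limsup (filtermap f F) g" by (rule Limsup_filtermap_ge)
  also have "\<dots> \<le> Limsup G g"
    unfolding Limsup_def using assms by (intro INF_superset_mono) (auto simp: filterlim_def le_filter_def)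
  finally show ?thesis .
qed

subsection \<open>One-sided derivatives of convex functions\<close>

text \<open>The slopes at \<open>x\<close> decrease towards \<open>x\<close> and are bounded below by the slope over \<open>{w..x}\<close>.\<close>

lemma convex_on_has_right_derivative:
  fixes f :: "real \<Rightarrow> real"
  assumes "convex_on {w..y} f" "w < x" "x < y"
  obtains D where "(f has_vector_derivative D) (at_right x)"
    "((\<lambda>q. (f q - f x) / (q - x)) \<longlongrightarrow> D) (at_right x)"
proof -
  define s where "s q = (f q - f x) / (q - x)" for q
  have mono: "s p \<le> s q" if "x < p" "p \<le> q" "q \<le> y" for p q
  proof (cases "p = q")
    case False
    then have "p < q" using that by simp
    have "(f x - f p) / (x - p) \<le> (f x - f q) / (x - q)"
      by (rule convex_on_slope_le[OF convex_on_subset[OF assms(1)], of "{x..q}" x q p])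
        (use that assms \<open>p < q\<close> in auto)
    moreover have "(f x - f p) / (x - p) = s p" "(f x - f q) / (x - q) = s q"
      unfolding s_def by (metis minus_diff_eq minus_divide_divide)+
    ultimately show ?thesis by simp
  qed simp
  have below: "(f w - f x) / (w - x) \<le> s q" if "x < q" "q \<le> y" for q
  proof -
    have "(f w - f x) / (w - x) \<le> (f x - f q) / (x - q)"
      using convex_on_slope_le[OF convex_on_subset[OF assms(1)], of "{w..q}" w q x] that assms
      by auto
    also have "(f x - f q) / (x - q) = s q"
      unfolding s_def by (metis minus_diff_eq minus_divide_divide)
    finally show ?thesis .
  qed
  define D where "D = Inf (s ` {x<..y})"
  have bdd: "bdd_below (s ` {x<..y})" using below by (intro bdd_belowI2) auto
  have lim: "(s \<longlongrightarrow> D) (at_right x)"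
  proof (rule order_tendstoI)
    fix c assume "c < D"
    show "\<forall>\<^sub>F q in at_right x. c < s q"
    proof (rule eventually_at_rightI)
      fix q assume "q \<in> {x<..<y}"
      then have "D \<le> s q" unfolding D_def by (intro cINF_lower bdd) auto
      with \<open>c < D\<close> show "c < s q" by simp
    qed fact
  next
    fix c assume "D < c"
    then obtain p where p: "x < p" "p \<le> y" "s p < c"
      unfolding D_def using assms by (subst (asm) cINF_less_iff) (auto intro: bdd)
    show "\<forall>\<^sub>F q in at_right x. s q < c"
    proof (rule eventually_at_rightI[OF _ p(1)])
      fix q assume "q \<in> {x<..<p}"
      then have "s q \<le> s p" using p by (intro mono) auto
      with p(3) show "s q < c" by simp
    qed
  qed
  have "(f has_field_derivative D) (at_right x)"
    using lim unfolding has_field_derivative_iff s_def .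
  then show ?thesis
    using that lim[unfolded s_def] by (simp add: has_real_derivative_iff_has_vector_derivative)
qed

text \<open>\<open>vector_derivative\<close> is a chosen value, meaningful only if a derivative
  exists. Convexity gives existence, and nontriviality of \<open>at_right x\<close> gives
  uniqueness.\<close>

lemma vector_derivative_at_right_convex:
  fixes f :: "real \<Rightarrow> real"
  assumes "convex_on {w..y} f" "w < x" "x < y"
  shows "((\<lambda>q. (f q - f x) / (q - x)) \<longlongrightarrow> vector_derivative f (at_right x)) (at_right x)"
  using convex_on_has_right_derivative[OF assms] vector_derivative_within[of x "{x<..}" f]
  by (metis trivial_limit_at_right_real)

text \<open>Reflection at the origin turns the left derivative at \<open>x\<close> into a right
  derivative at \<open>- x\<close>, with the opposite sign.\<close>

lemma vector_derivative_at_left_convex: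
  fixes f :: "real \<Rightarrow> real"
  assumes "convex_on {w..y} f" "w < x" "x < y"
  shows "((\<lambda>q. (f q - f x) / (q - x)) \<longlongrightarrow> vector_derivative f (at_left x)) (at_left x)"
proof -
  define g where "g q = f (- q)" for q
  have "convex_on {-y..-w} g"
    unfolding convex_on_def
  proof (intro conjI ballI allI impI)
    fix a b u v :: real assume *: "a \<in> {-y..-w}" "b \<in> {-y..-w}" "0 \<le> u" "0 \<le> v" "u + v = 1"
    then have "f (u *\<^sub>R (-a) + v *\<^sub>R (-b)) \<le> u * f (-a) + v * f (-b)"
      using assms(1)[THEN convex_onD, of v "-a" "-b"] by (simp add: eq_diff_eq[symmetric] add.commute)
    then show "g (u *\<^sub>R a + v *\<^sub>R b) \<le> u * g a + v * g b" by (simp add: g_def)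
  qed simp
  then obtain D where D: "((\<lambda>q. (g q - g (-x)) / (q - (-x))) \<longlongrightarrow> D) (at_right (-x))"
    by (rule convex_on_has_right_derivative[of "-y" "-w" g "-x"]) (use assms in auto)
  have "((\<lambda>q. - ((g (-q) - g (-x)) / (-q - (-x)))) \<longlongrightarrow> - D) (at_left x)"
    using D unfolding at_right_minus[of "-x"] filterlim_filtermap by (intro tendsto_intros) simp
  moreover have "- ((g (-q) - g (-x)) / (-q - (-x))) = (f q - f x) / (q - x)" for q
    unfolding g_def by (smt (verit) divide_minus_left minus_divide_right)
  ultimately have lim: "((\<lambda>q. (f q - f x) / (q - x)) \<longlongrightarrow> - D) (at_left x)" by simp
  then have "(f has_vector_derivative - D) (at_left x)"
    unfolding has_real_derivative_iff_has_vector_derivative[symmetric] has_field_derivative_iff .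
  with lim show ?thesis
    using vector_derivative_within[of x "{..<x}" f] by (metis trivial_limit_at_left_real)
qed

subsection \<open>Dyadic indices\<close>

text \<open>The point 1 is treated separately because the floor would give \<open>2 ^ k\<close>, one
  beyond the last cell.\<close>

definition dyadic_index :: "nat \<Rightarrow> real \<Rightarrow> nat" where
  "dyadic_index k s = (if s = 1 then 2 ^ k - 1 else nat \<lfloor>2 ^ k * s\<rfloor>)"

definition dyadic_indices :: "nat \<Rightarrow> (nat^'n) set" where
  "dyadic_indices k = {z. \<forall>i. z $ i < 2 ^ k}"

definition index_parent :: "nat^'n \<Rightarrow> nat^'n" where
  "index_parent z = (\<chi> i. z $ i div 2)"

text \<open>Replaces the half-open condition and its exceptional right end by a function of the
  point, so that disjointness, covering and nesting become facts about indices.\<close>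

lemma dyadic_index_iff:
  assumes "n < 2 ^ k"
  shows "real n / 2 ^ k \<le> s \<and> (s < (real n + 1) / 2 ^ k \<or> (n + 1 = 2 ^ k \<and> s = 1)) \<longleftrightarrow>
    0 \<le> s \<and> s \<le> 1 \<and> n = dyadic_index k s"
proof (cases "s = 1")
  case True
  have *: "real n + 1 \<le> 2 ^ k" using assms by (metis Suc_eq_plus1 Suc_leI of_nat_1 of_nat_add of_nat_le_iff of_nat_numeral of_nat_power)
  then have "\<not> 1 < (real n + 1) / 2 ^ k" "real n / 2 ^ k \<le> 1"
    using assms by (simp_all add: field_simps)
  with True show ?thesis using assms by (auto simp: dyadic_index_def)
next
  case False
  have *: "real n + 1 \<le> 2 ^ k" using assms by (metis Suc_eq_plus1 Suc_leI of_nat_1 of_nat_add of_nat_le_iff of_nat_numeral of_nat_power)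
  have "real n / 2 ^ k \<le> s \<and> s < (real n + 1) / 2 ^ k \<longleftrightarrow> \<lfloor>2 ^ k * s\<rfloor> = int n"
    by (auto simp: floor_eq_iff field_simps)
  moreover have "0 \<le> s \<and> s \<le> 1" if "real n / 2 ^ k \<le> s" "s < (real n + 1) / 2 ^ k"
  proof
    show "0 \<le> s" using that(1) by (rule order_trans[rotated]) simp
    have "(real n + 1) / 2 ^ k \<le> 1" using * by simp
    with that(2) show "s \<le> 1" by linarith
  qed
  moreover have "\<lfloor>2 ^ k * s\<rfloor> = int n \<longleftrightarrow> n = nat \<lfloor>2 ^ k * s\<rfloor>" if "0 \<le> s"
    using that by auto
  ultimately show ?thesis using False by (auto simp: dyadic_index_def)
qed

lemma dyadic_index_less:
  assumes "0 \<le> s" "s \<le> 1"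
  shows "dyadic_index k s < 2 ^ k"
proof (cases "s = 1")
  case False
  then have "2 ^ k * s < 2 ^ k" using assms by simp
  then have "\<lfloor>2 ^ k * s\<rfloor> < 2 ^ k" by (simp add: floor_less_iff)
  then show ?thesis using False assms by (simp add: dyadic_index_def nat_less_iff)
qed (simp add: dyadic_index_def)

text \<open>This is nestedness in one coordinate: rounding down before or after halving gives the
  same integer, and the last cell of level \<open>Suc k\<close> lies in the last cell of level
  \<open>k\<close>.\<close>

lemma dyadic_index_Suc_div:
  assumes "0 \<le> s" "s \<le> 1"
  shows "dyadic_index (Suc k) s div 2 = dyadic_index k s"
proof (cases "s = 1")
  case True
  have "(2 * 2 ^ k - 1) div 2 = (2 ^ k - 1 :: nat)" by presburger
  with True show ?thesis by (simp add: dyadic_index_def)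
next
  case False
  have "\<lfloor>2 ^ Suc k * s\<rfloor> div 2 = \<lfloor>2 ^ Suc k * s / 2\<rfloor>"
    using floor_divide_real_eq_div[of 2 "2 ^ Suc k * s"] by simp
  then show ?thesis using False assms
    by (simp add: dyadic_index_def mult.assoc flip: nat_div_distrib)
qed

lemma dyadic_indices_eq_image:
  "dyadic_indices k = (\<lambda>f. \<chi> i. f i) ` (UNIV \<rightarrow>\<^sub>E {..<2 ^ k} :: ('n::finite \<Rightarrow> nat) set)"
proof (intro equalityI subsetI)
  fix z :: "nat^'n" assume "z \<in> dyadic_indices k"
  then have "($) z \<in> UNIV \<rightarrow>\<^sub>E {..<2 ^ k}" by (auto simp: dyadic_indices_def)
  then show "z \<in> (\<lambda>f. \<chi> i. f i) ` (UNIV \<rightarrow>\<^sub>E {..<2 ^ k} :: ('n \<Rightarrow> nat) set)"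
    by (rule rev_image_eqI) simp
qed (auto simp: dyadic_indices_def)

lemma finite_dyadic_indices [simp, intro]: "finite (dyadic_indices k :: (nat^'n) set)"
  unfolding dyadic_indices_eq_image by (intro finite_imageI finite_PiE) auto

lemma card_dyadic_indices: "card (dyadic_indices k :: (nat^'n) set) \<le> 2 ^ (k * CARD('n))"
proof -
  have "card (dyadic_indices k :: (nat^'n) set) \<le> card (UNIV \<rightarrow>\<^sub>E {..<2 ^ k} :: ('n \<Rightarrow> nat) set)"
    unfolding dyadic_indices_eq_image by (intro card_image_le finite_PiE) auto
  then show ?thesis by (simp add: card_PiE power_mult)
qed

section \<open>Dyadic cubes as fibres of the index map\<close>

lemma mem_dyadic_cube_iff:
  assumes "z \<in> dyadic_indices k"
  shows "x \<in> dyadic_cube k z \<longleftrightarrow> x \<in> cbox 0 1 \<and> z = (\<chi> i. dyadic_index k (x $ i))"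
proof -
  have "x \<in> dyadic_cube k z \<longleftrightarrow> (\<forall>i. 0 \<le> x $ i \<and> x $ i \<le> 1 \<and> z $ i = dyadic_index k (x $ i))"
    unfolding dyadic_cube_def mem_Collect_eq
    by (rule iff_allI, rule dyadic_index_iff) (use assms in \<open>simp add: dyadic_indices_def\<close>)
  then show ?thesis by (auto simp: mem_box_cart vec_eq_iff)
qed

lemma dyadic_index_mem:
  "x \<in> cbox 0 1 \<Longrightarrow> (\<chi> i. dyadic_index k (x $ i)) \<in> dyadic_indices k"
  by (auto simp: dyadic_indices_def mem_box_cart intro!: dyadic_index_less)

lemma disjoint_dyadic_cube:
  assumes "z \<in> dyadic_indices k" "z' \<in> dyadic_indices k" "x \<in> dyadic_cube k z" "x \<in> dyadic_cube k z'"
  shows "z = z'"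
  using assms by (simp add: mem_dyadic_cube_iff)

lemma disjoint_family_dyadic_cube: "disjoint_family_on (dyadic_cube k) (dyadic_indices k)"
  using disjoint_dyadic_cube by (fastforce simp: disjoint_family_on_def)

lemma UN_dyadic_cube: "(\<Union>z\<in>dyadic_indices k. dyadic_cube k z) = cbox 0 1"
  using dyadic_index_mem by (fastforce simp: mem_dyadic_cube_iff)

text \<open>The lower corner belongs to its half-open cube. It serves as a witness point here and as
  a quantization point later.\<close>

definition dyadic_corner :: "nat \<Rightarrow> nat^'n \<Rightarrow> real^'n" where
  "dyadic_corner k z = (\<chi> i. real (z $ i) / 2 ^ k)"

lemma dyadic_corner_mem: "dyadic_corner k z \<in> dyadic_cube k z"
  by (simp add: dyadic_corner_def dyadic_cube_def divide_strict_right_mono)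

lemma dyadic_cubes_eq: "dyadic_cubes k = dyadic_cube k ` dyadic_indices k"
  by (auto simp: dyadic_cubes_def dyadic_indices_def)

lemma inj_on_dyadic_cube: "inj_on (dyadic_cube k) (dyadic_indices k)"
  using disjoint_dyadic_cube dyadic_corner_mem by (metis inj_onI)

lemma index_parent_mem: "z \<in> dyadic_indices (Suc k) \<Longrightarrow> index_parent z \<in> dyadic_indices k"
  by (simp add: dyadic_indices_def index_parent_def less_mult_imp_div_less mult.commute)

lemma dyadic_cube_subset_parent:
  assumes "z \<in> dyadic_indices (Suc k)"
  shows "dyadic_cube (Suc k) z \<subseteq> dyadic_cube k (index_parent z)"
proof
  fix x assume "x \<in> dyadic_cube (Suc k) z"
  then show "x \<in> dyadic_cube k (index_parent z)"
    unfolding mem_dyadic_cube_iff[OF assms] mem_dyadic_cube_iff[OF index_parent_mem[OF assms]]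
    by (auto simp: index_parent_def vec_eq_iff mem_box_cart dyadic_index_Suc_div)
qed

lemma dyadic_cube_eq_UN_children:
  assumes "w \<in> dyadic_indices k"
  shows "dyadic_cube k w = (\<Union>z\<in>{z \<in> dyadic_indices (Suc k). index_parent z = w}. dyadic_cube (Suc k) z)"
proof (intro equalityI subsetI)
  fix x assume x: "x \<in> dyadic_cube k w"
  let ?z = "\<chi> i. dyadic_index (Suc k) (x $ i)"
  have "x \<in> cbox 0 1" "w = (\<chi> i. dyadic_index k (x $ i))" using x assms by (auto simp: mem_dyadic_cube_iff)
  then have "?z \<in> dyadic_indices (Suc k)" "index_parent ?z = w" "x \<in> dyadic_cube (Suc k) ?z"
    by (auto simp: dyadic_index_mem mem_dyadic_cube_iff index_parent_def vec_eq_iff dyadic_index_Suc_div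
        mem_box_cart)
  then show "x \<in> (\<Union>z\<in>{z \<in> dyadic_indices (Suc k). index_parent z = w}. dyadic_cube (Suc k) z)" by blast
qed (use dyadic_cube_subset_parent in blast)

section \<open>Size, level and parent of a cube\<close>

lemma infnorm_le_iff: "infnorm (x :: real^'n) \<le> r \<longleftrightarrow> (\<forall>i. \<bar>x $ i\<bar> \<le> r)"
proof -
  have "infnorm x = Max (range (\<lambda>i. \<bar>x $ i\<bar>))"
    unfolding infnorm_cart by (subst cSup_eq_Max) (auto simp: full_SetCompr_eq)
  then show ?thesis by simp
qed

text \<open>The bound is not strict because a last cell also contains its right face.\<close>

lemma infnorm_dyadic_corner_le:
  assumes "z \<in> dyadic_indices k" "x \<in> dyadic_cube k z"
  shows "infnorm (x - dyadic_corner k z) \<le> 1 / 2 ^ k"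
  unfolding infnorm_le_iff
proof
  fix i
  have z: "real (z $ i) / 2 ^ k \<le> x $ i" "x $ i < (real (z $ i) + 1) / 2 ^ k \<or> (z $ i + 1 = 2 ^ k \<and> x $ i = 1)"
    using assms(2) by (auto simp: dyadic_cube_def)
  have "x $ i \<le> (real (z $ i) + 1) / 2 ^ k"
    using z(2)
  proof
    assume *: "z $ i + 1 = 2 ^ k \<and> x $ i = 1"
    then have "real (z $ i) + 1 = 2 ^ k" by (metis of_nat_1 of_nat_add of_nat_numeral of_nat_power)
    with * show ?thesis by simp
  qed simp
  with z(1) show "\<bar>(x - dyadic_corner k z) $ i\<bar> \<le> 1 / 2 ^ k"
    by (simp add: dyadic_corner_def add_divide_distrib abs_le_iff)
qed

text \<open>A cube of level \<open>k\<close> contains its corner and its midpoint, which are \<open>2\<^sup>-\<^sup>k\<^sup>-\<^sup>1\<close> apart.\<close>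

lemma dyadic_cube_level_le:
  fixes z z' :: "nat^'n"
  assumes "z \<in> dyadic_indices k" "z' \<in> dyadic_indices k'" "dyadic_cube k z \<subseteq> dyadic_cube k' z'"
  shows "k' \<le> k"
proof (rule ccontr)
  assume "\<not> k' \<le> k"
  then have kk: "Suc k \<le> k'" by simp
  define m :: "real^'n" where "m = (\<chi> i. (real (z $ i) + 1 / 2) / 2 ^ k)"
  \<comment> \<open>Types are nonempty, so some coordinate is available for the comparison.\<close>
  obtain i :: 'n where True by simp
  have "m \<in> dyadic_cube k z"
    by (auto simp: m_def dyadic_cube_def intro!: divide_right_mono divide_strict_right_mono)
  with assms(3) have m': "m \<in> dyadic_cube k' z'" by blast
  have c': "dyadic_corner k z \<in> dyadic_cube k' z'" using assms(3) dyadic_corner_mem by blast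
  have zi: "real (z $ i) + 1 \<le> 2 ^ k"
    using assms(1) unfolding dyadic_indices_def
    by (metis (mono_tags) Suc_eq_plus1 Suc_leI mem_Collect_eq of_nat_1 of_nat_add of_nat_le_iff of_nat_numeral of_nat_power)
  \<comment> \<open>Since the midpoint is below 1, the strict right bound applies to it. Corner and
    midpoint are then less than \<open>1 / 2 ^ k'\<close> apart in coordinate \<open>i\<close>,
    although they differ there by exactly \<open>1 / 2 ^ Suc k\<close>.\<close>
  then have "m $ i \<noteq> 1" by (simp add: m_def field_simps)
  with m' have "m $ i < (real (z' $ i) + 1) / 2 ^ k'" by (auto simp: dyadic_cube_def)
  moreover have "real (z' $ i) / 2 ^ k' \<le> real (z $ i) / 2 ^ k"
    using c' by (auto simp: dyadic_cube_def dyadic_corner_def)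
  moreover have "1 / 2 ^ k' \<le> (1 / 2 ^ Suc k :: real)"
    using kk by (intro divide_left_mono power_increasing) auto
  ultimately show False by (simp add: m_def add_divide_distrib)
qed

lemma dyadic_level_dyadic_cube:
  assumes "z \<in> dyadic_indices k"
  shows "dyadic_level (dyadic_cube k z) = k"
  unfolding dyadic_level_def
proof (rule the_equality)
  show "dyadic_cube k z \<in> dyadic_cubes k" using assms by (auto simp: dyadic_cubes_eq)
  fix j assume "dyadic_cube k z \<in> dyadic_cubes j"
  then obtain w where "w \<in> dyadic_indices j" "dyadic_cube k z = dyadic_cube j w"
    by (auto simp: dyadic_cubes_eq)
  with assms show "j = k" by (metis dyadic_cube_level_le le_antisym order_refl)
qed

lemma dyadic_parent_dyadic_cube:
  assumes "z \<in> dyadic_indices (Suc k)"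
  shows "dyadic_parent (dyadic_cube (Suc k) z) = dyadic_cube k (index_parent z)"
  unfolding dyadic_parent_def dyadic_level_dyadic_cube[OF assms] diff_Suc_1
proof (rule the_equality)
  show "dyadic_cube k (index_parent z) \<in> dyadic_cubes k \<and>
      dyadic_cube (Suc k) z \<subseteq> dyadic_cube k (index_parent z)"
    using index_parent_mem[OF assms] dyadic_cube_subset_parent[OF assms] by (simp add: dyadic_cubes_eq)
  fix R assume R: "R \<in> dyadic_cubes k \<and> dyadic_cube (Suc k) z \<subseteq> R"
  then obtain w where w: "w \<in> dyadic_indices k" "R = dyadic_cube k w" by (auto simp: dyadic_cubes_eq)
  \<comment> \<open>Uniqueness of the parent: the corner of the child lies in both candidates, and
    cubes of one level are disjoint.\<close>
  have "dyadic_corner (Suc k) z \<in> dyadic_cube k w" "dyadic_corner (Suc k) z \<in> dyadic_cube k (index_parent z)"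
    using R w dyadic_corner_mem dyadic_cube_subset_parent[OF assms] by blast+
  then show "R = dyadic_cube k (index_parent z)"
    using disjoint_dyadic_cube w index_parent_mem[OF assms] by blast
qed

lemma borel_measurable_vec_nth: "(\<lambda>x::real^'n. x $ i) \<in> borel_measurable borel"
  by (intro borel_measurable_continuous_onI continuous_intros)

lemma dyadic_cube_borel [measurable]: "dyadic_cube k (z::nat^'n) \<in> sets borel"
proof -
  note borel_measurable_vec_nth [measurable]
  have "{x \<in> space borel. \<forall>i. real (z $ i) / 2 ^ k \<le> x $ i \<and>
     (x $ i < (real (z $ i) + 1) / 2 ^ k \<or> (z $ i + 1 = 2 ^ k \<and> x $ i = 1))} \<in> sets borel"
    by measurable
  then show ?thesis by (simp add: dyadic_cube_def)
qed

text \<open>In each coordinate at most five indices of level \<open>k\<close> belong to cubes meeting the ball.\<close>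

lemma card_dyadic_cubes_meeting_ball:
  fixes y :: "real^'n" and k :: nat
  defines "B \<equiv> {z \<in> dyadic_indices k. \<exists>x\<in>dyadic_cube k z. infnorm (x - y) < 1 / 2 ^ k}"
  shows "card B \<le> 5 ^ CARD('n)"
proof -
  \<comment> \<open>Indices of cubes meeting the ball satisfy
    \<open>2 ^ k * y $ i - 2 < z $ i < 2 ^ k * y $ i + 1\<close>; rounding down and truncating at 0
    keeps them among these five values.\<close>
  define S where "S i = {nat \<lfloor>2 ^ k * y $ i - 2\<rfloor>..<nat \<lfloor>2 ^ k * y $ i - 2\<rfloor> + 5}" for i
  have "B \<subseteq> (\<lambda>f. \<chi> i. f i) ` (Pi\<^sub>E UNIV S)"
  proof
    fix z assume "z \<in> B"
    then obtain x where z: "z \<in> dyadic_indices k" and x: "x \<in> dyadic_cube k z" "infnorm (x - y) < 1 / 2 ^ k"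
      by (auto simp: B_def)
    have "z $ i \<in> S i" for i
    proof -
      have "\<bar>x $ i - y $ i\<bar> < 1 / 2 ^ k" using component_le_infnorm_cart[of "x - y" i] x(2) by simp
      then have 1: "2 ^ k * x $ i < 2 ^ k * y $ i + 1" "2 ^ k * y $ i < 2 ^ k * x $ i + 1"
        by (auto simp: abs_less_iff field_simps)
      have "\<bar>x $ i - real (z $ i) / 2 ^ k\<bar> \<le> 1 / 2 ^ k"
        using component_le_infnorm_cart[of "x - dyadic_corner k z" i] infnorm_dyadic_corner_le[OF z x(1)]
        by (simp add: dyadic_corner_def)
      moreover have "real (z $ i) / 2 ^ k \<le> x $ i" using x(1) by (auto simp: dyadic_cube_def)
      ultimately have 2: "real (z $ i) \<le> 2 ^ k * x $ i" "2 ^ k * x $ i \<le> real (z $ i) + 1"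
        by (auto simp: abs_le_iff field_simps)
      from 1 2 have "real (z $ i) < 2 ^ k * y $ i + 1" "2 ^ k * y $ i - 2 < real (z $ i)" by linarith+
      then show ?thesis unfolding S_def by simp linarith
    qed
    then have "($) z \<in> Pi\<^sub>E UNIV S" by auto
    then show "z \<in> (\<lambda>f. \<chi> i. f i) ` (Pi\<^sub>E UNIV S)" by (rule rev_image_eqI) simp
  qed
  moreover have fin: "finite (Pi\<^sub>E UNIV S)" by (intro finite_PiE) (auto simp: S_def)
  ultimately have "card B \<le> card (Pi\<^sub>E UNIV S)" by (rule surj_card_le[rotated])
  also have "\<dots> = 5 ^ CARD('n)" by (simp add: card_PiE S_def)
  finally show ?thesis .
qed

subsection \<open>The stopping length\<close>

text \<open>A point outside the support lies in a basic open null set, and a countable basis has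
  only countably many of those.\<close>

lemma AE_mem_msupport:
  fixes M :: "'a::second_countable_topology measure"
  assumes "sets M = sets borel"
  shows "AE x in M. x \<in> msupport M"
proof -
  obtain B :: "'a set set" where B: "countable B" "topological_basis B"
    using ex_countable_basis by blast
  have "AE x in M. \<forall>b\<in>{b \<in> B. emeasure M b = 0}. x \<notin> b"
  proof (subst AE_ball_countable)
    show "\<forall>b\<in>{b \<in> B. emeasure M b = 0}. AE x in M. x \<notin> b"
    proof
      fix b assume "b \<in> {b \<in> B. emeasure M b = 0}"
      then have "b \<in> null_sets M"
        using topological_basis_open[OF B(2)] assms by (auto intro!: null_setsI)
      then show "AE x in M. x \<notin> b" by (rule AE_not_in)
    qed
  qed (use B(1) in \<open>auto intro: countable_subset\<close>)
  then show ?thesis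
  proof (rule AE_mp, intro AE_I2 impI)
    fix x assume x: "\<forall>b\<in>{b \<in> B. emeasure M b = 0}. x \<notin> b"
    show "x \<in> msupport M"
      unfolding msupport_def
    proof (intro CollectI allI impI)
      fix U assume U: "open U \<and> x \<in> U"
      then obtain b where b: "b \<in> B" "x \<in> b" "b \<subseteq> U" using topological_basisE[OF B(2)] by blast
      have "0 < emeasure M b" using x b by (auto simp: zero_less_iff_neq_zero)
      also have "\<dots> \<le> emeasure M U" using U b assms by (intro emeasure_mono) auto
      finally show "0 < emeasure M U" .
    qed
  qed
qed

section \<open>Masses of cubes and of the heavy cubes\<close>

locale dyadic_decay = prob_space \<nu> for \<nu> :: "(real^'n) measure" +
  fixes a C :: real
  assumes sets_eq: "sets \<nu> = sets borel"
    and AE_cbox: "AE x in \<nu>. x \<in> cbox 0 1"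
    and a_pos: "a > 0" and C_ge: "C \<ge> 1"
    and decay: "\<And>k Q. Q \<in> dyadic_cubes k \<Longrightarrow> measure \<nu> Q \<le> C * 2 powr (- a * real k)"
begin

abbreviation mass :: "nat \<Rightarrow> nat^'n \<Rightarrow> real" where
  "mass k z \<equiv> measure \<nu> (dyadic_cube k z)"

definition heavy :: "nat \<Rightarrow> real \<Rightarrow> (nat^'n) set" where
  "heavy k t = {z \<in> dyadic_indices k. t \<le> mass k z}"

definition heavy_mass :: "nat \<Rightarrow> real \<Rightarrow> real" where
  "heavy_mass k t = (\<Sum>z\<in>heavy k t. mass k z)"

lemma cube_sets [measurable]: "dyadic_cube k z \<in> sets \<nu>"
  by (simp add: sets_eq dyadic_cube_borel)

lemma cbox_sets [measurable]: "cbox 0 1 \<in> sets \<nu>"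
  by (simp add: sets_eq)

lemma finite_heavy [simp]: "finite (heavy k t)"
  by (simp add: heavy_def)

lemma measure_UN_cubes:
  assumes "Z \<subseteq> dyadic_indices k"
  shows "measure \<nu> (\<Union>z\<in>Z. dyadic_cube k z) = (\<Sum>z\<in>Z. mass k z)"
proof (rule finite_measure_finite_Union)
  show "finite Z" using assms finite_dyadic_indices finite_subset by blast
  show "disjoint_family_on (dyadic_cube k) Z"
    using assms disjoint_family_dyadic_cube unfolding disjoint_family_on_def by blast
qed auto

lemma sum_mass: "(\<Sum>z\<in>dyadic_indices k. mass k z) = 1"
proof -
  have "measure \<nu> (cbox 0 1) = 1" using AE_cbox by (subst prob_eq_1) auto
  then show ?thesis using measure_UN_cubes[OF order_refl, of k] by (simp add: UN_dyadic_cube)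
qed

lemma mass_eq_sum_children:
  assumes "w \<in> dyadic_indices k"
  shows "mass k w = (\<Sum>z\<in>{z \<in> dyadic_indices (Suc k). index_parent z = w}. mass (Suc k) z)"
  by (subst dyadic_cube_eq_UN_children[OF assms], rule measure_UN_cubes) auto

lemma mass_le_parent: "z \<in> dyadic_indices (Suc k) \<Longrightarrow> mass (Suc k) z \<le> mass k (index_parent z)"
  by (intro finite_measure_mono dyadic_cube_subset_parent) auto

lemma mass_le: "z \<in> dyadic_indices k \<Longrightarrow> mass k z \<le> C * 2 powr (- a * real k)"
  by (rule decay) (auto simp: dyadic_cubes_eq)

lemma heavy_mass_nonneg: "0 \<le> heavy_mass k t"
  by (simp add: heavy_mass_def sum_nonneg)

lemma heavy_mass_le_1: "heavy_mass k t \<le> 1"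
  unfolding heavy_mass_def sum_mass[of k, symmetric]
  by (intro sum_mono2) (auto simp: heavy_def)

lemma heavy_mass_eq_0: "C * 2 powr (- a * real k) < t \<Longrightarrow> heavy_mass k t = 0"
  using mass_le by (force simp: heavy_mass_def heavy_def intro!: sum.neutral)

lemma heavy_mass_antimono: "s \<le> t \<Longrightarrow> heavy_mass k t \<le> heavy_mass k s"
  unfolding heavy_mass_def by (intro sum_mono2) (auto simp: heavy_def)

text \<open>The root cube carries the full mass. This level contributes exactly 1 to the stopping
  length, hence the bound \<open>stopping_length_ge_1\<close> and the loss of 1 in the quantization
  estimate.\<close>

lemma heavy_mass_0: "t \<le> 1 \<Longrightarrow> heavy_mass 0 t = 1"
proof -
  assume t: "t \<le> 1"
  have eq: "dyadic_indices 0 = {0 :: nat^'n}" by (auto simp: dyadic_indices_def vec_eq_iff)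
  then have "mass 0 0 = 1" using sum_mass[of 0] by simp
  with t have "heavy 0 t = {0}" unfolding heavy_def eq by force
  with \<open>mass 0 0 = 1\<close> show ?thesis by (simp add: heavy_mass_def)
qed

lemma heavy_mass_eq: "heavy_mass k t = 1 - (\<Sum>z\<in>{z \<in> dyadic_indices k. mass k z < t}. mass k z)"
proof -
  have "dyadic_indices k = heavy k t \<union> {z \<in> dyadic_indices k. mass k z < t}"
    by (auto simp: heavy_def)
  then have "1 = (\<Sum>z\<in>heavy k t \<union> {z \<in> dyadic_indices k. mass k z < t}. mass k z)"
    using sum_mass[of k] by simp
  also have "\<dots> = heavy_mass k t + (\<Sum>z\<in>{z \<in> dyadic_indices k. mass k z < t}. mass k z)"
    unfolding heavy_mass_def by (intro sum.union_disjoint) (auto simp: heavy_def)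
  finally show ?thesis by simp
qed

text \<open>The children of heavy cubes are either heavy themselves or stop at this level, and every
  heavy cube has a heavy parent because mass grows towards the parent.\<close>

lemma sum_stopping_level:
  "(\<Sum>z\<in>{z \<in> dyadic_indices (Suc k). mass (Suc k) z < t \<and> t \<le> mass k (index_parent z)}. mass (Suc k) z)
    = heavy_mass k t - heavy_mass (Suc k) t"
proof -
  let ?W = "{z \<in> dyadic_indices (Suc k). mass (Suc k) z < t \<and> t \<le> mass k (index_parent z)}"
  have "heavy_mass k t =
      (\<Sum>w\<in>heavy k t. \<Sum>z\<in>{z \<in> dyadic_indices (Suc k). index_parent z = w}. mass (Suc k) z)"
    unfolding heavy_mass_def by (intro sum.cong mass_eq_sum_children) (auto simp: heavy_def)
  also have "\<dots> = (\<Sum>w\<in>heavy k t. \<Sum>z\<in>{z \<in> {z \<in> dyadic_indices (Suc k). index_parent z \<in> heavy k t}.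
      index_parent z = w}. mass (Suc k) z)"
    by (intro sum.cong refl) auto
  also have "\<dots> = (\<Sum>z\<in>{z \<in> dyadic_indices (Suc k). index_parent z \<in> heavy k t}. mass (Suc k) z)"
    by (intro sum.group) auto
  also have "{z \<in> dyadic_indices (Suc k). index_parent z \<in> heavy k t} = heavy (Suc k) t \<union> ?W"
    using mass_le_parent by (force simp: heavy_def intro: index_parent_mem)
  also have "sum (mass (Suc k)) \<dots> = heavy_mass (Suc k) t + sum (mass (Suc k)) ?W"
    unfolding heavy_mass_def by (intro sum.union_disjoint) (auto simp: heavy_def)
  finally show ?thesis by simp
qed

text \<open>Abel summation: a cube of the stopping partition counts once for each of its proper
  ancestors, which are exactly the heavy cubes containing it.\<close>

lemma stopping_length_eq:
  assumes "0 < t" "C * 2 powr (- a * real K) < t"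
  shows "stopping_length \<nu> t = (\<Sum>k<K. heavy_mass k t)"
proof -
  define W where "W k = {z \<in> dyadic_indices (Suc k).
    0 < mass (Suc k) z \<and> mass (Suc k) z < t \<and> t \<le> mass k (index_parent z)}" for k
  \<comment> \<open>The parent of a stopping cube is heavy, and the decay leaves no heavy cubes from
    level \<open>K\<close> on.\<close>
  have WK: "k < K" if "z \<in> W k" for k z
  proof (rule ccontr)
    assume "\<not> k < K"
    then have "C * 2 powr (- a * real k) \<le> C * 2 powr (- a * real K)"
      using C_ge a_pos by (intro mult_left_mono) auto
    moreover have "t \<le> C * 2 powr (- a * real k)"
      using that mass_le[of "index_parent z" k] index_parent_mem[of z k] by (auto simp: W_def)
    ultimately show False using assms by simp
  qed
  have P: "stopping_partition \<nu> t = (\<Union>k<K. dyadic_cube (Suc k) ` W k)"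
  proof (intro equalityI subsetI)
    fix Q assume Q: "Q \<in> stopping_partition \<nu> t"
    then obtain j where "Q \<in> dyadic_cubes j" "Q \<notin> dyadic_cubes 0"
      by (auto simp: stopping_partition_def all_dyadic_cubes_def)
    then obtain k where "Q \<in> dyadic_cubes (Suc k)" by (cases j) auto
    then obtain z where z: "z \<in> dyadic_indices (Suc k)" "Q = dyadic_cube (Suc k) z"
      by (auto simp: dyadic_cubes_eq)
    then have "z \<in> W k"
      using Q dyadic_parent_dyadic_cube[OF z(1)] by (auto simp: stopping_partition_def W_def)
    with WK z show "Q \<in> (\<Union>k<K. dyadic_cube (Suc k) ` W k)" by blast
  next
    fix Q assume "Q \<in> (\<Union>k<K. dyadic_cube (Suc k) ` W k)"
    then obtain k z where z: "z \<in> W k" "Q = dyadic_cube (Suc k) z" by blast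
    then have zi: "z \<in> dyadic_indices (Suc k)" by (simp add: W_def)
    have "Q \<notin> dyadic_cubes 0"
    proof
      assume "Q \<in> dyadic_cubes 0"
      then obtain w where w: "w \<in> dyadic_indices 0" "Q = dyadic_cube 0 w"
        unfolding dyadic_cubes_eq by blast
      show False using dyadic_level_dyadic_cube[OF w(1)] dyadic_level_dyadic_cube[OF zi] w(2) z(2) by simp
    qed
    with z zi dyadic_parent_dyadic_cube[OF zi] show "Q \<in> stopping_partition \<nu> t"
      by (auto simp: stopping_partition_def W_def all_dyadic_cubes_def dyadic_cubes_eq)
  qed
  have level: "dyadic_level Q = Suc k" if "Q \<in> dyadic_cube (Suc k) ` W k" for Q k
    using that by (auto simp: W_def dyadic_level_dyadic_cube)
  have "stopping_length \<nu> t = (\<Sum>Q\<in>stopping_partition \<nu> t. measure \<nu> Q * dyadic_level Q)"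
    by (simp add: stopping_length_def side_length_def sum_negf)
  also have "\<dots> = (\<Sum>k<K. \<Sum>Q\<in>dyadic_cube (Suc k) ` W k. measure \<nu> Q * dyadic_level Q)"
    unfolding P
  proof (intro sum.UNION_disjoint ballI impI)
    fix i j :: nat assume "i \<noteq> j"
    then show "dyadic_cube (Suc i) ` W i \<inter> dyadic_cube (Suc j) ` W j = {}"
      using level[of _ i] level[of _ j] by fastforce
  qed (auto simp: W_def)
  also have "\<dots> = (\<Sum>k<K. real (Suc k) * (heavy_mass k t - heavy_mass (Suc k) t))"
  proof (rule sum.cong[OF refl])
    fix k
    have "(\<Sum>Q\<in>dyadic_cube (Suc k) ` W k. measure \<nu> Q * dyadic_level Q)
        = (\<Sum>z\<in>W k. mass (Suc k) z * real (Suc k))"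
      by (subst sum.reindex) (auto simp: W_def dyadic_level_dyadic_cube
          intro!: inj_on_subset[OF inj_on_dyadic_cube])
    also have "\<dots> = (\<Sum>z\<in>W k. mass (Suc k) z) * real (Suc k)" by (simp only: sum_distrib_right)
    \<comment> \<open>The stopping partition omits cubes of mass zero, which do not change the
      sum.\<close>
    also have "(\<Sum>z\<in>W k. mass (Suc k) z) = heavy_mass k t - heavy_mass (Suc k) t"
      unfolding sum_stopping_level[symmetric]
      by (intro sum.mono_neutral_left) (auto simp: W_def zero_less_measure_iff)
    finally show "(\<Sum>Q\<in>dyadic_cube (Suc k) ` W k. measure \<nu> Q * dyadic_level Q)
        = real (Suc k) * (heavy_mass k t - heavy_mass (Suc k) t)" by (simp only: mult.commute)
  qed
  \<comment> \<open>Summation by parts; the boundary term vanishes since level \<open>K\<close> has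
    no heavy cubes.\<close>
  also have "\<dots> = (\<Sum>k<K. heavy_mass k t) - K * heavy_mass K t"
    by (induction K) (auto simp: algebra_simps)
  finally show ?thesis using heavy_mass_eq_0[OF assms(2)] by simp
qed

lemma ex_decay_level: "0 < t \<Longrightarrow> \<exists>K. C * 2 powr (- a * real K) < t"
proof -
  assume "0 < t"
  have "(\<lambda>K. C * 2 powr (- a * real K)) \<longlonglongrightarrow> 0"
    using a_pos by real_asymp
  from order_tendstoD(2)[OF this \<open>0 < t\<close>] show ?thesis by (auto simp: eventually_sequentially)
qed

lemma sum_heavy_mass_le: "0 < t \<Longrightarrow> (\<Sum>k<n. heavy_mass k t) \<le> stopping_length \<nu> t"
proof -
  assume t: "0 < t"
  then obtain K where K: "C * 2 powr (- a * real K) < t" using ex_decay_level by blast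
  have zero: "heavy_mass k t = 0" if "k \<ge> K" for k
  proof (rule heavy_mass_eq_0)
    have "C * 2 powr (- a * real k) \<le> C * 2 powr (- a * real K)"
      using C_ge a_pos that by (intro mult_left_mono) auto
    with K show "C * 2 powr (- a * real k) < t" by simp
  qed
  have "(\<Sum>k<n. heavy_mass k t) = (\<Sum>k\<in>{..<n} \<inter> {..<K}. heavy_mass k t)"
    by (intro sum.mono_neutral_right) (auto simp: not_less intro!: zero)
  also have "\<dots> \<le> (\<Sum>k<K. heavy_mass k t)"
    by (intro sum_mono2) (auto simp: heavy_mass_nonneg)
  finally show ?thesis using stopping_length_eq[OF t K] by simp
qed

lemma stopping_length_antimono:
  assumes "0 < s" "s \<le> t"
  shows "stopping_length \<nu> t \<le> stopping_length \<nu> s"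
proof -
  \<comment> \<open>A level beyond all heavy cubes for \<open>s\<close> also works for the larger
    \<open>t\<close>, so both lengths are sums over the same levels and can be compared
    termwise.\<close>
  obtain K where K: "C * 2 powr (- a * real K) < s" using ex_decay_level assms by blast
  then have "stopping_length \<nu> t = (\<Sum>k<K. heavy_mass k t)" using assms by (intro stopping_length_eq) auto
  also have "\<dots> \<le> (\<Sum>k<K. heavy_mass k s)" by (intro sum_mono heavy_mass_antimono assms)
  also have "\<dots> = stopping_length \<nu> s" using assms(1) K by (rule stopping_length_eq[symmetric])
  finally show ?thesis .
qed

lemma stopping_length_ge_1: "0 < t \<Longrightarrow> t \<le> 1 \<Longrightarrow> 1 \<le> stopping_length \<nu> t"
  using sum_heavy_mass_le[of t 1] heavy_mass_0[of t] by simp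

text \<open>There are at most \<open>2 ^ (k * CARD('n))\<close> light cubes, each of mass below
  \<open>t\<close>.\<close>

lemma heavy_mass_ge: "0 < t \<Longrightarrow> 1 - 2 ^ (k * CARD('n)) * t \<le> heavy_mass k t"
proof -
  assume t: "0 < t"
  have "(\<Sum>z\<in>{z \<in> dyadic_indices k. mass k z < t}. mass k z)
      \<le> real (card {z \<in> dyadic_indices k. mass k z < t}) * t"
    using sum_bounded_above[of "{z \<in> dyadic_indices k. mass k z < t}" "mass k" t] by fastforce
  also have "\<dots> \<le> real (2 ^ (k * CARD('n))) * t"
    using card_mono[of "dyadic_indices k" "{z \<in> dyadic_indices k. mass k z < t}"]
      card_dyadic_indices[where 'n = 'n, of k] t by (intro mult_right_mono) (auto simp del: of_nat_power)
  finally show ?thesis by (simp add: heavy_mass_eq)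
qed

text \<open>On each fixed level the heavy mass tends to 1 as \<open>t\<close> tends to 0, so the
  first \<open>n\<close> levels together eventually exceed any bound below \<open>n\<close>.\<close>

lemma filterlim_stopping_length: "filterlim (stopping_length \<nu>) at_top (at_right 0)"
  unfolding filterlim_at_top
proof
  fix Z :: real
  define n where "n = nat \<lceil>Z\<rceil> + 1"
  have n: "Z < n" unfolding n_def by linarith
  have "((\<lambda>t::real. \<Sum>k<n. 1 - 2 ^ (k * CARD('n)) * t) \<longlongrightarrow> (\<Sum>k<n. 1 - 2 ^ (k * CARD('n)) * 0)) (at_right 0)"
    by (intro tendsto_intros)
  then have "\<forall>\<^sub>F t in at_right 0. Z < (\<Sum>k<n. 1 - 2 ^ (k * CARD('n)) * t)"
    by (rule order_tendstoD(1)) (use n in simp)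
  moreover have "\<forall>\<^sub>F t in at_right 0. (0::real) < t" by (simp add: eventually_at_right_less)
  ultimately show "\<forall>\<^sub>F t in at_right 0. Z \<le> stopping_length \<nu> t"
  proof eventually_elim
    case (elim t)
    have "(\<Sum>k<n. 1 - 2 ^ (k * CARD('n)) * t) \<le> (\<Sum>k<n. heavy_mass k t)"
      using elim by (intro sum_mono heavy_mass_ge)
    also have "\<dots> \<le> stopping_length \<nu> t" using elim by (intro sum_heavy_mass_le)
    finally show ?case using elim by simp
  qed
qed

end

subsection \<open>Quantization error\<close>

lemma max_setdist_eq_Min:
  assumes "finite A" "A \<noteq> {}"
  shows "max_setdist x A = Min ((\<lambda>y. infnorm (x - y)) ` A)"
  unfolding max_setdist_def using assms by (intro cInf_eq_Min) auto

lemma max_setdist_less_iff: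
  assumes "finite A" "A \<noteq> {}"
  shows "max_setdist x A < r \<longleftrightarrow> (\<exists>y\<in>A. infnorm (x - y) < r)"
  unfolding max_setdist_eq_Min[OF assms] using assms by (subst Min_less_iff) auto

lemma max_setdist_le:
  assumes "finite A" "y \<in> A"
  shows "max_setdist x A \<le> infnorm (x - y)"
proof -
  have "A \<noteq> {}" using assms by auto
  with assms show ?thesis by (simp add: max_setdist_eq_Min)
qed

lemma max_setdist_nonneg:
  assumes "finite A" "A \<noteq> {}"
  shows "0 \<le> max_setdist x A"
  using assms by (simp add: max_setdist_eq_Min infnorm_pos_le)

lemma max_setdist_pos:
  assumes "finite A" "A \<noteq> {}" "x \<notin> A"
  shows "0 < max_setdist x A"
proof -
  have "x - y \<noteq> 0" if "y \<in> A" for y using that assms by auto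
  then show ?thesis using assms by (auto simp: max_setdist_eq_Min infnorm_pos_lt)
qed

lemma borel_measurable_max_setdist [measurable]:
  fixes A :: "(real^'n) set"
  assumes "finite A" "A \<noteq> {}"
  shows "(\<lambda>x. max_setdist x A) \<in> borel_measurable borel"
proof (rule borel_measurable_iff_less[THEN iffD2], intro allI)
  fix r
  have "open {x. infnorm (x - y) < r}" for y :: "real^'n"
    by (intro open_Collect_less continuous_intros)
  then have "open (\<Union>y\<in>A. {x. infnorm (x - y) < r})" by blast
  moreover have "{x \<in> space borel. max_setdist x A < r} = (\<Union>y\<in>A. {x. infnorm (x - y) < r})"
    using assms by (auto simp: max_setdist_less_iff)
  ultimately show "{x \<in> space borel. max_setdist x A < r} \<in> sets borel" by simp
qed

text \<open>The right side counts the \<open>k\<close> with \<open>k < - log 2 d\<close>, and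
  rounding up makes this count large enough. For \<open>1 \<le> d\<close>, and for
  \<open>d = 0\<close> by the default value of the logarithm, the left side is 0.\<close>

lemma neg_log_le_suminf_indicator:
  fixes d :: real
  assumes "0 \<le> d"
  shows "ennreal (- log 2 d) \<le> (\<Sum>k. indicator {x. x < 1 / 2 ^ k} d)"
proof (cases "0 < d \<and> d < 1")
  case True
  define n where "n = nat \<lceil>- log 2 d\<rceil>"
  have "- log 2 d \<le> real n" unfolding n_def by linarith
  then have "ennreal (- log 2 d) \<le> of_nat n" by (simp add: ennreal_leI ennreal_of_nat_eq_real_of_nat)
  also have "\<dots> = (\<Sum>k<n. indicator {x. x < 1 / 2 ^ k} d :: ennreal)"
  proof -
    have "d < 1 / 2 ^ k" if "k < n" for k
    proof -
      have "real k < - log 2 d" using that unfolding n_def by linarith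
      then have "log 2 d < - real k" by simp
      then have "d < 2 powr (- real k)" using True by (simp add: log_less_iff)
      then show ?thesis by (simp add: powr_minus powr_realpow field_simps)
    qed
    then have "(\<Sum>k<n. indicator {x. x < 1 / 2 ^ k} d :: ennreal) = (\<Sum>k<n. 1)"
      by (intro sum.cong) auto
    then show ?thesis by simp
  qed
  also have "\<dots> \<le> (\<Sum>k. indicator {x. x < 1 / 2 ^ k} d)" by (intro sum_le_suminf) auto
  finally show ?thesis .
next
  case False
  then have "- log 2 d \<le> 0" using assms by (cases "d = 0") (auto simp: log_def)
  then show ?thesis by (simp add: ennreal_neg)
qed

section \<open>Lower bound for the quantization error\<close>

context dyadic_decay
begin

lemma borel_measurable_max_setdist_nu:
  assumes "finite A" "A \<noteq> {}"
  shows "(\<lambda>x. max_setdist x A) \<in> borel_measurable \<nu>"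
  using borel_measurable_max_setdist[OF assms] sets_eq by (simp cong: measurable_cong_sets)

text \<open>The neighbourhood is covered by the cubes in \<open>Y\<close>, at most
  \<open>5 ^ CARD('n) * N\<close> of them. A light cube has mass below \<open>t\<close> and at most
  the decay bound, hence at most their geometric mean with weights \<open>1 - \<delta>\<close> and
  \<open>\<delta>\<close>; for \<open>0 < \<delta>\<close> it is summable over \<open>k\<close>, and
  for \<open>\<delta> < 1\<close> it keeps a power of \<open>t\<close> to offset
  \<open>N\<close>.\<close>

lemma measure_near_le:
  assumes A: "finite A" "A \<noteq> {}" "card A \<le> N" and \<delta>: "0 \<le> \<delta>" "\<delta> \<le> 1" and t: "0 < t"
  shows "measure \<nu> {x. max_setdist x A < 1 / 2 ^ k}
    \<le> heavy_mass k t + 5 ^ CARD('n) * real N * (t powr (1 - \<delta>) * (C * 2 powr (- a * real k)) powr \<delta>)"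
proof -
  define Z where "Z y = {z \<in> dyadic_indices k. \<exists>x\<in>dyadic_cube k z. infnorm (x - y) < 1 / 2 ^ k}"
    for y :: "real^'n"
  define Y where "Y = (\<Union>y\<in>A. Z y)"
  define u where "u = t powr (1 - \<delta>) * (C * 2 powr (- a * real k)) powr \<delta>"
  have u0: "0 \<le> u" unfolding u_def using C_ge by (intro mult_nonneg_nonneg) auto
  have Y: "Y \<subseteq> dyadic_indices k" by (auto simp: Y_def Z_def)
  have finY: "finite Y" using Y finite_dyadic_indices by (rule finite_subset)
  have "card Y \<le> (\<Sum>y\<in>A. card (Z y))" unfolding Y_def by (rule card_UN_le) fact
  also have "\<dots> \<le> (\<Sum>y\<in>A. 5 ^ CARD('n))"
    unfolding Z_def by (intro sum_mono card_dyadic_cubes_meeting_ball)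
  also have "\<dots> \<le> 5 ^ CARD('n) * N" using A by simp
  finally have cardY: "real (card Y) \<le> 5 ^ CARD('n) * real N"
    by (metis of_nat_le_iff of_nat_mult of_nat_numeral of_nat_power)
  have small: "mass k z \<le> u" if "z \<in> dyadic_indices k" "mass k z < t" for z
  proof -
    have "mass k z = mass k z powr (1 - \<delta>) * mass k z powr \<delta>"
      by (cases "mass k z = 0") (auto simp: zero_less_measure_iff simp flip: powr_add)
    also have "\<dots> \<le> u"
      unfolding u_def using that \<delta> mass_le[of z k] by (intro mult_mono powr_mono2) auto
    finally show ?thesis .
  qed
  have "measure \<nu> {x. max_setdist x A < 1 / 2 ^ k} \<le> measure \<nu> (\<Union>z\<in>Y. dyadic_cube k z)"
  proof (rule finite_measure_mono_AE)
    show "AE x in \<nu>. x \<in> {x. max_setdist x A < 1 / 2 ^ k} \<longrightarrow> x \<in> (\<Union>z\<in>Y. dyadic_cube k z)"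
      using AE_cbox
    proof eventually_elim
      case (elim x)
      show ?case
      proof
        assume "x \<in> {x. max_setdist x A < 1 / 2 ^ k}"
        then obtain y where y: "y \<in> A" "infnorm (x - y) < 1 / 2 ^ k"
          using A by (auto simp: max_setdist_less_iff)
        from elim obtain z where "z \<in> dyadic_indices k" "x \<in> dyadic_cube k z"
          unfolding UN_dyadic_cube[of k, symmetric] by blast
        with y show "x \<in> (\<Union>z\<in>Y. dyadic_cube k z)" by (auto simp: Y_def Z_def)
      qed
    qed
  qed (use finY in auto)
  also have "\<dots> = (\<Sum>z\<in>Y. mass k z)" by (rule measure_UN_cubes) fact
  also have "\<dots> \<le> (\<Sum>z\<in>Y. (if t \<le> mass k z then mass k z else 0) + u)"
    using small Y u0 by (intro sum_mono) (auto simp: subset_iff)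
  also have "\<dots> = (\<Sum>z\<in>{z \<in> Y. t \<le> mass k z}. mass k z) + real (card Y) * u"
    using finY by (simp add: sum.distrib sum.inter_filter)
  also have "(\<Sum>z\<in>{z \<in> Y. t \<le> mass k z}. mass k z) \<le> heavy_mass k t"
    unfolding heavy_mass_def using Y by (intro sum_mono2) (auto simp: heavy_def)
  also have "real (card Y) * u \<le> 5 ^ CARD('n) * real N * u"
    by (rule mult_right_mono[OF cardY u0])
  finally show ?thesis by (simp add: u_def)
qed

text \<open>With \<open>N t\<^sup>1\<^sup>-\<^sup>\<delta> = 1\<close> the error terms form a geometric series that does not depend on \<open>N\<close>.\<close>

lemma sum_measure_near_le:
  assumes A: "finite A" "A \<noteq> {}" "card A \<le> N" and \<delta>: "0 < \<delta>" "\<delta> < 1"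
  shows "(\<Sum>k<n. measure \<nu> {x. max_setdist x A < 1 / 2 ^ k})
    \<le> stopping_length \<nu> (real N powr (- (1 / (1 - \<delta>))))
      + 5 ^ CARD('n) * C powr \<delta> / (1 - 2 powr (- a * \<delta>))"
proof -
  have N: "0 < N" using A card_gt_0_iff by (metis less_le_trans)
  define t where "t = real N powr (- (1 / (1 - \<delta>)))"
  have t: "0 < t" using N by (simp add: t_def)
  have "t powr (1 - \<delta>) = real N powr (- 1)"
    unfolding t_def powr_powr using \<delta> by simp
  then have Nt: "real N * t powr (1 - \<delta>) = 1"
    using N by (simp add: powr_minus)
  define q where "q = 2 powr (- a * \<delta>)"
  have q: "0 < q" "q < 1" unfolding q_def using a_pos \<delta> by (auto simp: powr_less_one)
  have "(\<Sum>k<n. measure \<nu> {x. max_setdist x A < 1 / 2 ^ k})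
      \<le> (\<Sum>k<n. heavy_mass k t + 5 ^ CARD('n) * C powr \<delta> * q ^ k)"
  proof (rule sum_mono)
    fix k
    have "(C * 2 powr (- a * real k)) powr \<delta> = C powr \<delta> * q ^ k"
      using C_ge by (simp add: powr_mult q_def powr_powr powr_power mult_ac)
    then have eq: "5 ^ CARD('n) * real N * (t powr (1 - \<delta>) * (C * 2 powr (- a * real k)) powr \<delta>)
        = (real N * t powr (1 - \<delta>)) * (5 ^ CARD('n) * C powr \<delta> * q ^ k)" by (simp only: mult_ac)
    show "measure \<nu> {x. max_setdist x A < 1 / 2 ^ k} \<le> heavy_mass k t + 5 ^ CARD('n) * C powr \<delta> * q ^ k"
      using measure_near_le[OF A less_imp_le[OF \<delta>(1)] less_imp_le[OF \<delta>(2)] t, of k]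
      unfolding eq Nt mult_1 .
  qed
  also have "\<dots> = (\<Sum>k<n. heavy_mass k t) + 5 ^ CARD('n) * C powr \<delta> * (\<Sum>k<n. q ^ k)"
    by (simp add: sum.distrib sum_distrib_left)
  also have "(\<Sum>k<n. heavy_mass k t) \<le> stopping_length \<nu> t" by (rule sum_heavy_mass_le[OF t])
  also have "(\<Sum>k<n. q ^ k) \<le> (\<Sum>k. q ^ k)" using q by (intro sum_le_suminf summable_geometric) auto
  also have "\<dots> = 1 / (1 - q)" using q by (intro suminf_geometric) auto
  finally show ?thesis using C_ge by (simp add: t_def q_def)
qed

text \<open>Integrating the count of levels termwise turns it into the sum of the masses of the
  neighbourhoods.\<close>

lemma nn_integral_neg_log_dist_le:
  assumes A: "finite A" "A \<noteq> {}"
    and W: "\<And>n. (\<Sum>k<n. measure \<nu> {x. max_setdist x A < 1 / 2 ^ k}) \<le> W"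
  shows "(\<integral>\<^sup>+x. ennreal (- log 2 (max_setdist x A)) \<partial>\<nu>) \<le> ennreal W"
proof -
  note borel_measurable_max_setdist_nu[OF A, measurable]
  have "(\<integral>\<^sup>+x. ennreal (- log 2 (max_setdist x A)) \<partial>\<nu>)
      \<le> (\<integral>\<^sup>+x. (\<Sum>k. indicator {x. x < 1 / 2 ^ k} (max_setdist x A)) \<partial>\<nu>)"
    by (intro nn_integral_mono neg_log_le_suminf_indicator max_setdist_nonneg A)
  also have "\<dots> = (\<Sum>k. \<integral>\<^sup>+x. indicator {x. x < 1 / 2 ^ k} (max_setdist x A) \<partial>\<nu>)"
    by (rule nn_integral_suminf) measurable
  also have "\<dots> = (\<Sum>k. emeasure \<nu> {x. max_setdist x A < 1 / 2 ^ k})"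
  proof (rule arg_cong[where f = suminf], rule ext)
    fix k
    have [measurable]: "{x. max_setdist x A < 1 / 2 ^ k} \<in> sets \<nu>"
      using borel_measurable_max_setdist[OF A] by (simp add: sets_eq borel_measurable_iff_less)
    have "(\<integral>\<^sup>+x. indicator {x. x < 1 / 2 ^ k} (max_setdist x A) \<partial>\<nu>)
        = (\<integral>\<^sup>+x. indicator {x. max_setdist x A < 1 / 2 ^ k} x \<partial>\<nu>)"
      by (intro nn_integral_cong) (auto simp: indicator_def)
    then show "(\<integral>\<^sup>+x. indicator {x. x < 1 / 2 ^ k} (max_setdist x A) \<partial>\<nu>)
        = emeasure \<nu> {x. max_setdist x A < 1 / 2 ^ k}" by simp
  qed
  also have "\<dots> \<le> ennreal W"
  proof (rule suminf_le_const)
    show "(\<Sum>k<n. emeasure \<nu> {x. max_setdist x A < 1 / 2 ^ k}) \<le> ennreal W" for n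
      using W[of n] by (simp add: emeasure_eq_measure sum_nonneg ennreal_leI)
  qed auto
  finally show ?thesis .
qed

lemma integral_ln_dist_ge:
  assumes A: "finite A" "A \<noteq> {}"
    and W: "\<And>n. (\<Sum>k<n. measure \<nu> {x. max_setdist x A < 1 / 2 ^ k}) \<le> W"
  shows "- (W * ln 2) \<le> (\<integral>x. ln (max_setdist x A) \<partial>\<nu>)"
proof -
  \<comment> \<open>The empty partial sum gives \<open>0 \<le> W\<close>, which
    \<open>integral_real_bounded\<close> requires to pass from the positive part to the Bochner
    integral.\<close>
  have "0 \<le> W" using W[of 0] by simp
  then have "(\<integral>x. - log 2 (max_setdist x A) \<partial>\<nu>) \<le> W"
    using nn_integral_neg_log_dist_le[OF assms] by (intro integral_real_bounded)
  moreover have "(\<integral>x. ln (max_setdist x A) \<partial>\<nu>) = (\<integral>x. - log 2 (max_setdist x A) \<partial>\<nu>) * - ln 2"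
    by (subst integral_mult_left_zero[symmetric]) (simp add: log_def)
  ultimately show ?thesis
    using mult_right_mono[of "- (\<integral>x. log 2 (max_setdist x A) \<partial>\<nu>)" W "ln 2"] by simp
qed

text \<open>The negative part is controlled by the count of levels. The positive part is bounded
  because points of the unit cube have distance at most \<open>1 + infnorm y\<close> from any
  \<open>y\<close> in \<open>A\<close>.\<close>

lemma integrable_ln_dist:
  assumes A: "finite A" "A \<noteq> {}"
    and W: "\<And>n. (\<Sum>k<n. measure \<nu> {x. max_setdist x A < 1 / 2 ^ k}) \<le> W"
  shows "integrable \<nu> (\<lambda>x. ln (max_setdist x A))"
proof (rule integrableI_bounded)
  note borel_measurable_max_setdist_nu[OF A, measurable]
  show "(\<lambda>x. ln (max_setdist x A)) \<in> borel_measurable \<nu>" by measurable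
  obtain y where y: "y \<in> A" using A by blast
  define M where "M = ln (1 + infnorm y)"
  have M: "0 \<le> M" by (simp add: M_def infnorm_pos_le)
  have "(\<integral>\<^sup>+x. ennreal (norm (ln (max_setdist x A))) \<partial>\<nu>)
      \<le> (\<integral>\<^sup>+x. ennreal (ln 2) * ennreal (- log 2 (max_setdist x A)) + ennreal M \<partial>\<nu>)"
  proof (rule nn_integral_mono_AE, use AE_cbox in eventually_elim)
    case (elim x)
    have "infnorm x \<le> 1" using elim unfolding infnorm_le_iff by (auto simp: mem_box_cart)
    then have "infnorm (x - y) \<le> 1 + infnorm y"
      using infnorm_triangle[of x "- y"] by (simp add: infnorm_neg)
    then have d: "max_setdist x A \<le> 1 + infnorm y" using max_setdist_le[OF A(1) y, of x] by linarith
    show ?case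
    proof (cases "ln (max_setdist x A) \<le> 0")
      case True
      then have "ennreal (norm (ln (max_setdist x A))) = ennreal (ln 2) * ennreal (- log 2 (max_setdist x A))"
        by (simp add: log_def divide_nonpos_pos flip: ennreal_mult)
      then show ?thesis by simp
    next
      case False
      then have "0 < max_setdist x A" using max_setdist_nonneg[OF A, of x] by (cases "max_setdist x A = 0") auto
      then have "ln (max_setdist x A) \<le> M" using d by (simp add: M_def)
      then have "ennreal (norm (ln (max_setdist x A))) \<le> ennreal M" using False by (simp add: ennreal_leI)
      then show ?thesis by (simp add: add_increasing)
    qed
  qed
  also have "\<dots> = ennreal (ln 2) * (\<integral>\<^sup>+x. ennreal (- log 2 (max_setdist x A)) \<partial>\<nu>) + ennreal M"
    by (subst nn_integral_add) (auto simp: nn_integral_cmult emeasure_space_1)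
  also have "\<dots> \<le> ennreal (ln 2) * ennreal W + ennreal M"
    by (intro add_mono mult_left_mono nn_integral_neg_log_dist_le[OF assms]) auto
  also have "\<dots> < \<infinity>" by (simp add: ennreal_mult_less_top)
  finally show "(\<integral>\<^sup>+x. ennreal (norm (ln (max_setdist x A))) \<partial>\<nu>) < \<infinity>" .
qed

text \<open>The bound on the mean logarithm is the same for all admissible \<open>A\<close>, so it
  survives the infimum.\<close>

lemma quant_error0_ge:
  assumes "0 < N" "0 < \<delta>" "\<delta> < 1"
  defines "W \<equiv> stopping_length \<nu> (real N powr (- (1 / (1 - \<delta>))))
      + 5 ^ CARD('n) * C powr \<delta> / (1 - 2 powr (- a * \<delta>))"
  shows "2 powr - W \<le> quant_error0 \<nu> N"
  unfolding quant_error0_def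
proof (rule cINF_greatest)
  have "{0} \<in> {A :: (real^'n) set. finite A \<and> 1 \<le> card A \<and> card A \<le> N}" using assms by simp
  then show "{A :: (real^'n) set. finite A \<and> 1 \<le> card A \<and> card A \<le> N} \<noteq> {}" by blast
  fix A :: "(real^'n) set" assume "A \<in> {A. finite A \<and> 1 \<le> card A \<and> card A \<le> N}"
  then have A: "finite A" "A \<noteq> {}" "card A \<le> N" by auto
  have "2 powr - W = exp (- (W * ln 2))" by (simp add: powr_def)
  also have "\<dots> \<le> exp (\<integral>x. ln (max_setdist x A) \<partial>\<nu>)"
    using integral_ln_dist_ge[OF A(1,2) sum_measure_near_le[OF A assms(2,3)]] by (simp add: W_def)
  finally show "2 powr - W \<le> exp (\<integral>x. ln (max_setdist x A) \<partial>\<nu>)" .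
qed

lemma quant_error0_pos: "0 < N \<Longrightarrow> 0 < quant_error0 \<nu> N"
  by (rule less_le_trans[OF _ quant_error0_ge[of N "1/2"]]) auto

lemma neg_log_quant_error0_le:
  assumes "0 < N" "0 < \<delta>" "\<delta> < 1"
  shows "- log 2 (quant_error0 \<nu> N) \<le> stopping_length \<nu> (real N powr (- (1 / (1 - \<delta>))))
      + 5 ^ CARD('n) * C powr \<delta> / (1 - 2 powr (- a * \<delta>))"
proof -
  have "- W \<le> log 2 (quant_error0 \<nu> N)" if "2 powr - W \<le> quant_error0 \<nu> N" for W
    using that quant_error0_pos[OF assms(1)] by (simp add: le_log_iff)
  from this[OF quant_error0_ge[OF assms]] show ?thesis by linarith
qed

section \<open>Upper bound for the quantization error\<close>

lemma AE_not_singleton: "AE x in \<nu>. x \<noteq> y"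
proof (cases "y \<in> cbox 0 1")
  case True
  \<comment> \<open>The point lies in a cube of every level, and the masses of these cubes tend to
    0.\<close>
  have "measure \<nu> {y} \<le> C * 2 powr (- a * real k)" for k
  proof -
    obtain z where z: "z \<in> dyadic_indices k" "y \<in> dyadic_cube k z"
      using True unfolding UN_dyadic_cube[of k, symmetric] by blast
    have "measure \<nu> {y} \<le> mass k z" using z by (intro finite_measure_mono) auto
    then show ?thesis using mass_le[OF z(1)] by simp
  qed
  then have "\<not> 0 < measure \<nu> {y}" using ex_decay_level by (meson not_less)
  then have "{y} \<in> null_sets \<nu>"
    by (intro null_setsI) (auto simp: emeasure_eq_measure zero_less_measure_iff sets_eq)
  from AE_not_in[OF this] show ?thesis by simp
next
  case False
  with AE_cbox show ?thesis by (auto elim: eventually_mono)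
qed

text \<open>Quantize with the corners of all heavy cubes.\<close>

lemma neg_log_quant_error0_ge:
  assumes t: "0 < t" "t \<le> 1" and K: "C * 2 powr (- a * real K) < t" and N: "real K / t \<le> real N"
  shows "stopping_length \<nu> t - 1 \<le> - log 2 (quant_error0 \<nu> N)"
proof -
  define A where "A = (\<Union>k<K. dyadic_corner k ` heavy k t)"
  define U where "U k = (\<Union>z\<in>heavy k t. dyadic_cube k z)" for k
  \<comment> \<open>For \<open>K = 0\<close> the decay bound would be \<open>C\<close>, which is at
    least 1 and hence not below \<open>t\<close>.\<close>
  have K0: "0 < K" using K C_ge t by (cases K) auto
  have finA: "finite A" by (simp add: A_def)
  \<comment> \<open>The heavy cubes of one level are disjoint and have mass at least
    \<open>t\<close> each; over \<open>K\<close> levels this allows at most \<open>K / t\<close>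
    corners.\<close>
  have "real (card (heavy k t)) \<le> 1 / t" for k
  proof -
    have "real (card (heavy k t)) * t \<le> heavy_mass k t"
      unfolding heavy_mass_def by (rule sum_bounded_below) (simp add: heavy_def)
    also have "\<dots> \<le> 1" by (rule heavy_mass_le_1)
    finally show ?thesis using t by (simp add: field_simps)
  qed
  note card_heavy = this
  have "card A \<le> (\<Sum>k<K. card (dyadic_corner k ` heavy k t))" unfolding A_def by (rule card_UN_le) simp
  also have "\<dots> \<le> (\<Sum>k<K. card (heavy k t))" by (intro sum_mono card_image_le) simp
  finally have "real (card A) \<le> (\<Sum>k<K. real (card (heavy k t)))"
    by (metis of_nat_le_iff of_nat_sum)
  also have "\<dots> \<le> (\<Sum>k<K. 1 / t)" by (intro sum_mono card_heavy)
  also have "\<dots> \<le> real N" using N by simp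
  finally have cardA: "card A \<le> N" by simp
  have "heavy 0 t \<noteq> {}" using heavy_mass_0[of t] t by (auto simp: heavy_mass_def)
  then obtain z0 where z0: "z0 \<in> heavy 0 t" by blast
  have A0: "dyadic_corner 0 z0 \<in> A" using z0 K0 by (auto simp: A_def)
  then have neA: "A \<noteq> {}" by blast
  have N0: "0 < N" using cardA finA neA card_gt_0_iff by (metis less_le_trans)
  have near: "max_setdist x A \<le> 1 / 2 ^ k" if "k < K" "x \<in> U k" for x k
  proof -
    obtain z where z: "z \<in> heavy k t" "x \<in> dyadic_cube k z" using \<open>x \<in> U k\<close> by (auto simp: U_def)
    then have "dyadic_corner k z \<in> A" using \<open>k < K\<close> by (auto simp: A_def)
    then show ?thesis
      using max_setdist_le[OF finA, of _ x] infnorm_dyadic_corner_le[of z k x] z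
      by (fastforce simp: heavy_def)
  qed
  have [measurable]: "U k \<in> sets \<nu>" for k unfolding U_def by auto
  have [simp]: "integrable \<nu> (indicat_real (U k))" for k
    by (intro integrable_real_indicator) (auto simp: emeasure_eq_measure)
  \<comment> \<open>Off \<open>A\<close> the distance is positive, so the logarithm takes no default
    value.\<close>
  have "AE x in \<nu>. \<forall>y\<in>A. x \<noteq> y" using finA AE_not_singleton by (intro AE_finite_allI)
  with AE_cbox have "AE x in \<nu>. ln (max_setdist x A) \<le> - ln 2 * (\<Sum>k\<in>{1..<K}. indicator (U k) x)"
  proof eventually_elim
    case (elim x)
    define d where "d = max_setdist x A"
    have d0: "0 < d" unfolding d_def using elim by (intro max_setdist_pos finA neA) auto
    \<comment> \<open>The corner of the root cube keeps the distance at most 1, which settles the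
      case where \<open>x\<close> lies in no heavy cube of positive level.\<close>
    have "x \<in> U 0"
    proof -
      obtain z where "z \<in> dyadic_indices 0" "x \<in> dyadic_cube 0 z"
        using elim unfolding UN_dyadic_cube[of 0, symmetric] by blast
      moreover have "z = z0" using z0 calculation(1) by (auto simp: heavy_def dyadic_indices_def vec_eq_iff)
      ultimately show ?thesis using z0 by (auto simp: U_def)
    qed
    then have d1: "d \<le> 1" using near[of 0 x] K0 by (simp add: d_def)
    \<comment> \<open>As a set of positive levels, \<open>S\<close> has at most \<open>Max S\<close>
      elements, and \<open>d \<le> 1 / 2 ^ Max S\<close>. Leaving out level 0 costs the 1 in the
      conclusion.\<close>
    define S where "S = {k \<in> {1..<K}. x \<in> U k}"
    have "real (card S) \<le> - log 2 d"
    proof (cases "S = {}")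
      case False
      have finS: "finite S" by (simp add: S_def)
      have "S \<subseteq> {1..Max S}" using finS by (auto simp: S_def)
      then have "card S \<le> Max S" by (metis card_atLeastAtMost card_mono diff_Suc_1 finite_atLeastAtMost)
      moreover have "Max S \<in> S" using finS False by simp
      then have "d \<le> 1 / 2 ^ Max S" unfolding d_def by (intro near) (auto simp: S_def)
      then have "d \<le> 2 powr (- real (Max S))" by (simp add: powr_minus powr_realpow field_simps)
      then have "log 2 d \<le> - real (Max S)" using d0 by (simp add: log_le_iff)
      ultimately show ?thesis by linarith
    qed (use d0 d1 in simp)
    then have "ln d \<le> - ln 2 * real (card S)" using d0 by (simp add: log_def field_simps)
    moreover have "real (card S) = (\<Sum>k\<in>{1..<K}. indicator (U k) x)"
      by (simp add: S_def indicator_def sum.If_cases Int_def)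
    ultimately show ?case by (simp add: d_def)
  qed
  \<comment> \<open>Monotonicity of the Bochner integral needs both sides integrable; the choice
    \<open>\<delta> = 1/2\<close> supplies a finite bound for the logarithm.\<close>
  then have "(\<integral>x. ln (max_setdist x A) \<partial>\<nu>) \<le> (\<integral>x. - ln 2 * (\<Sum>k\<in>{1..<K}. indicator (U k) x) \<partial>\<nu>)"
    by (rule integral_mono_AE[rotated 2])
      (auto intro!: integrable_ln_dist[OF finA neA sum_measure_near_le[OF finA neA cardA, of "1/2"]]
        Bochner_Integration.integrable_sum)
  also have "\<dots> = - ln 2 * (\<Sum>k\<in>{1..<K}. measure \<nu> (U k))"
    by (subst integral_mult_right_zero, subst Bochner_Integration.integral_sum) auto
  also have "(\<Sum>k\<in>{1..<K}. measure \<nu> (U k)) = (\<Sum>k\<in>{1..<K}. heavy_mass k t)"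
    unfolding U_def heavy_mass_def by (intro sum.cong refl measure_UN_cubes) (auto simp: heavy_def)
  also have "\<dots> = (\<Sum>k<K. heavy_mass k t) - heavy_mass 0 t"
    using K0 by (simp add: lessThan_atLeast0 sum.atLeast_Suc_lessThan)
  also have "\<dots> = stopping_length \<nu> t - 1" using stopping_length_eq[OF t(1) K] heavy_mass_0[OF t(2)] by simp
  finally have "exp (\<integral>x. ln (max_setdist x A) \<partial>\<nu>) \<le> exp (- ln 2 * (stopping_length \<nu> t - 1))"
    by simp
  also have "\<dots> = 2 powr - (stopping_length \<nu> t - 1)" by (simp add: powr_def algebra_simps)
  finally have "exp (\<integral>x. ln (max_setdist x A) \<partial>\<nu>) \<le> 2 powr - (stopping_length \<nu> t - 1)" .
  moreover have "quant_error0 \<nu> N \<le> exp (\<integral>x. ln (max_setdist x A) \<partial>\<nu>)"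
    unfolding quant_error0_def
  proof (rule cINF_lower)
    show "A \<in> {A. finite A \<and> 1 \<le> card A \<and> card A \<le> N}"
      using finA cardA neA by (simp add: Suc_le_eq card_gt_0_iff)
    show "bdd_below ((\<lambda>A. exp (\<integral>x. ln (max_setdist x A) \<partial>\<nu>)) ` {A. finite A \<and> 1 \<le> card A \<and> card A \<le> N})"
      by (rule bdd_belowI2[of _ 0]) simp
  qed
  ultimately have "quant_error0 \<nu> N \<le> 2 powr - (stopping_length \<nu> t - 1)" by (rule order_trans[rotated])
  then have "log 2 (quant_error0 \<nu> N) \<le> - (stopping_length \<nu> t - 1)"
    by (subst log_le_iff) (use quant_error0_pos[OF N0] in auto)
  then show ?thesis by simp
qed

end

subsection \<open>The spectrum\<close>

context dyadic_decay
begin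

text \<open>Cubes of mass zero may be included because \<open>0 powr q = 0\<close>.\<close>

definition power_sum :: "nat \<Rightarrow> real \<Rightarrow> real" where
  "power_sum k q = (\<Sum>z\<in>dyadic_indices k. mass k z powr q)"

definition spec :: "real \<Rightarrow> real" where
  "spec q = real_of_ereal (upper_spectrum \<nu> q)"

lemma spectrum_at_eq: "spectrum_at \<nu> k q = 1 / real k * log 2 (power_sum k q)"
proof -
  have "{Q \<in> dyadic_cubes k. 0 < measure \<nu> Q} = dyadic_cube k ` {z \<in> dyadic_indices k. 0 < mass k z}"
    by (auto simp: dyadic_cubes_eq)
  then have "(\<Sum>Q\<in>{Q \<in> dyadic_cubes k. 0 < measure \<nu> Q}. measure \<nu> Q powr q)
      = (\<Sum>z\<in>{z \<in> dyadic_indices k. 0 < mass k z}. mass k z powr q)"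
    by (subst sum.reindex[symmetric, unfolded comp_def])
      (auto intro!: inj_on_subset[OF inj_on_dyadic_cube])
  also have "\<dots> = power_sum k q"
    unfolding power_sum_def by (intro sum.mono_neutral_left) (auto simp: zero_less_measure_iff)
  finally show ?thesis by (simp add: spectrum_at_def)
qed

lemma power_sum_1: "power_sum k 1 = 1"
  using sum_mass[of k] by (simp add: power_sum_def)

lemma power_sum_le: "0 \<le> q \<Longrightarrow> power_sum k q \<le> 2 ^ (k * CARD('n))"
proof -
  assume "0 \<le> q"
  then have "power_sum k q \<le> real (card (dyadic_indices k :: (nat^'n) set)) * 1"
    unfolding power_sum_def by (intro sum_bounded_above) (simp add: powr_le1)
  also have "\<dots> \<le> real (2 ^ (k * CARD('n)))" using card_dyadic_indices[where 'n = 'n, of k] by (simp del: of_nat_power)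
  finally show ?thesis by simp
qed

text \<open>By pigeonhole some cube has mass at least \<open>2 powr (- real (k * CARD('n)))\<close>,
  and its term alone suffices.\<close>

lemma power_sum_ge: "0 \<le> q \<Longrightarrow> 2 powr (- real (k * CARD('n)) * q) \<le> power_sum k q"
proof -
  assume q: "0 \<le> q"
  define \<epsilon> :: real where "\<epsilon> = 2 powr (- real (k * CARD('n)))"
  have "\<exists>z\<in>dyadic_indices k. \<epsilon> \<le> mass k z"
  proof (rule ccontr)
    assume "\<not> ?thesis"
    then have less: "mass k z < \<epsilon>" if "z \<in> dyadic_indices k" for z using that by (simp add: not_le)
    have "card (dyadic_indices k :: (nat^'n) set) > 0"
      using sum_mass[of k] by (auto simp: card_gt_0_iff)
    then have "(\<Sum>z\<in>dyadic_indices k. mass k z) < real (card (dyadic_indices k :: (nat^'n) set)) * \<epsilon>"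
      using less by (intro sum_bounded_above_strict) auto
    also have "\<dots> \<le> real (2 ^ (k * CARD('n))) * \<epsilon>"
      using card_dyadic_indices[where 'n = 'n, of k] by (intro mult_right_mono) (auto simp: \<epsilon>_def simp del: of_nat_power)
    also have "\<dots> = 1" by (simp add: \<epsilon>_def powr_minus powr_realpow del: of_nat_mult)
    finally show False by (simp add: sum_mass)
  qed
  then obtain z where z: "z \<in> dyadic_indices k" "\<epsilon> \<le> mass k z" by blast
  have "2 powr (- real (k * CARD('n)) * q) = \<epsilon> powr q" by (simp only: \<epsilon>_def powr_powr)
  also have "\<dots> \<le> mass k z powr q" using z q by (intro powr_mono2) (auto simp: \<epsilon>_def)
  also have "\<dots> \<le> power_sum k q" unfolding power_sum_def using z by (intro member_le_sum) auto
  finally show ?thesis .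
qed

lemma power_sum_pos: "0 \<le> q \<Longrightarrow> 0 < power_sum k q"
  by (rule less_le_trans[OF _ power_sum_ge]) auto

text \<open>Hoelder's inequality, by weighted AM-GM on the normalized summands.\<close>

lemma log_power_sum_convex:
  assumes "0 \<le> x" "0 \<le> y" "0 \<le> u" "0 \<le> v" "u + v = 1"
  shows "log 2 (power_sum k (u * x + v * y)) \<le> u * log 2 (power_sum k x) + v * log 2 (power_sum k y)"
proof -
  define X Y where "X = power_sum k x" and "Y = power_sum k y"
  have pos: "0 < X" "0 < Y" using power_sum_pos assms by (auto simp: X_def Y_def)
  have "power_sum k (u * x + v * y) / (X powr u * Y powr v)
      = (\<Sum>z\<in>dyadic_indices k. mass k z powr (u * x + v * y) / (X powr u * Y powr v))"
    by (simp add: power_sum_def sum_divide_distrib)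
  also have "\<dots> \<le> (\<Sum>z\<in>dyadic_indices k. u * (mass k z powr x / X) + v * (mass k z powr y / Y))"
  proof (rule sum_mono)
    fix z
    show "mass k z powr (u * x + v * y) / (X powr u * Y powr v)
        \<le> u * (mass k z powr x / X) + v * (mass k z powr y / Y)"
    proof (cases "mass k z = 0")
      case False
      then have "0 < mass k z" by (simp add: zero_less_measure_iff)
      then have "(mass k z powr x / X) powr u * (mass k z powr y / Y) powr v
          \<le> u * (mass k z powr x / X) + v * (mass k z powr y / Y)"
        using pos assms by (intro Youngs_inequality_0) auto
      then show ?thesis using pos by (simp add: powr_divide powr_powr powr_add mult.commute)
    qed (use assms pos in simp)
  qed
  also have "\<dots> = u * ((\<Sum>z\<in>dyadic_indices k. mass k z powr x) / X)
      + v * ((\<Sum>z\<in>dyadic_indices k. mass k z powr y) / Y)"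
    by (simp add: sum.distrib sum_distrib_left sum_divide_distrib)
  also have "\<dots> = 1" using pos assms unfolding power_sum_def[symmetric] X_def[symmetric] Y_def[symmetric] by simp
  finally have "power_sum k (u * x + v * y) \<le> X powr u * Y powr v" using pos by simp
  then have "log 2 (power_sum k (u * x + v * y)) \<le> log 2 (X powr u * Y powr v)"
    using power_sum_pos[of "u * x + v * y" k] assms pos by simp
  also have "\<dots> = u * log 2 X + v * log 2 Y" using pos by (simp add: log_mult log_powr)
  finally show ?thesis by (simp add: X_def Y_def)
qed

text \<open>Bounds independent of \<open>k\<close> make the upper spectrum finite, so that
  \<open>spec\<close> loses nothing.\<close>

lemma spectrum_at_bounds:
  fixes q :: real
  assumes "0 \<le> q" "0 < k"
  shows "- (CARD('n) * q) \<le> spectrum_at \<nu> k q" "spectrum_at \<nu> k q \<le> CARD('n)"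
proof -
  have "- real (k * CARD('n)) * q \<le> log 2 (power_sum k q)"
    using power_sum_ge[OF assms(1)] power_sum_pos[OF assms(1)] by (subst le_log_iff) auto
  then have "k * (- (CARD('n) * q)) \<le> k * spectrum_at \<nu> k q"
    using assms by (simp add: spectrum_at_eq mult.assoc)
  then show "- (CARD('n) * q) \<le> spectrum_at \<nu> k q" using assms(2) by (subst (asm) mult_le_cancel_left_pos) auto
  have "log 2 (power_sum k q) \<le> log 2 (2 ^ (k * CARD('n)))"
    using power_sum_le[OF assms(1)] power_sum_pos[OF assms(1)] by (subst log_le_cancel_iff) auto
  also have "\<dots> = real k * CARD('n)" by (simp add: log_nat_power)
  finally have "k * spectrum_at \<nu> k q \<le> k * CARD('n)"
    using assms by (simp add: spectrum_at_eq)
  then show "spectrum_at \<nu> k q \<le> CARD('n)" using assms by (simp add: mult_le_cancel_left)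
qed

lemma upper_spectrum_eq: 
  assumes "0 \<le> q"
  shows "upper_spectrum \<nu> q = ereal (spec q)"
proof -
  have "upper_spectrum \<nu> q \<le> ereal CARD('n)"
    unfolding upper_spectrum_def
    by (intro Limsup_bounded eventually_mono[OF eventually_gt_at_top[of 0]])
      (use spectrum_at_bounds(2)[OF assms] in auto)
  moreover have "ereal (- (CARD('n) * q)) \<le> upper_spectrum \<nu> q"
    unfolding upper_spectrum_def
    by (intro le_Limsup eventually_mono[OF eventually_gt_at_top[of 0]])
      (use spectrum_at_bounds(1)[OF assms] in auto)
  ultimately show ?thesis by (cases "upper_spectrum \<nu> q") (auto simp: spec_def)
qed

lemma spec_less_imp_eventually:
  assumes "0 \<le> q" "spec q < r"
  shows "\<forall>\<^sub>F k in sequentially. spectrum_at \<nu> k q < r"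
proof -
  have "upper_spectrum \<nu> q < ereal r" using upper_spectrum_eq[OF assms(1)] assms(2) by simp
  from Limsup_lessD[OF this[unfolded upper_spectrum_def]] show ?thesis by simp
qed

lemma eventually_imp_spec_le:
  assumes "0 \<le> q" "\<forall>\<^sub>F k in sequentially. spectrum_at \<nu> k q \<le> r"
  shows "spec q \<le> r"
proof -
  have "upper_spectrum \<nu> q \<le> ereal r"
    unfolding upper_spectrum_def using assms(2) by (intro Limsup_bounded) simp
  then show ?thesis using upper_spectrum_eq[OF assms(1)] by simp
qed

lemma spec_1: "spec 1 = 0"
  by (simp add: spec_def upper_spectrum_def spectrum_at_eq power_sum_1 Limsup_const)

text \<open>Masses are at most 1, so lowering the exponent from 1 can only raise the power sum above
  its value 1.\<close>

lemma spec_nonneg: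
  assumes "0 \<le> q" "q \<le> 1"
  shows "0 \<le> spec q"
proof -
  have "power_sum k 1 \<le> power_sum k q" for k
    unfolding power_sum_def using assms by (intro sum_mono powr_mono') auto
  then have p: "1 \<le> power_sum k q" for k by (simp add: power_sum_1)
  have "0 \<le> log 2 (power_sum k q)" for k
    using p[of k] by (subst zero_le_log_cancel_iff) auto
  then have "0 \<le> upper_spectrum \<nu> q"
    unfolding upper_spectrum_def spectrum_at_eq by (intro le_Limsup always_eventually allI) auto
  then show ?thesis using upper_spectrum_eq[OF assms(1)] by simp
qed

text \<open>Every finite level is convex by Hoelder, and an upper limit preserves convexity. The
  interval has 1 in its interior, as both one-sided derivatives require.\<close>

lemma convex_on_spec: "convex_on {0..2} spec"
  unfolding convex_on_def
proof (intro conjI ballI allI impI)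
  fix x y u v :: real
  assume *: "x \<in> {0..2}" "y \<in> {0..2}" "0 \<le> u" "0 \<le> v" "u + v = 1"
  show "spec (u *\<^sub>R x + v *\<^sub>R y) \<le> u * spec x + v * spec y"
  proof (rule field_le_epsilon)
    fix e :: real assume e: "0 < e"
    have "\<forall>\<^sub>F k in sequentially. spectrum_at \<nu> k x < spec x + e"
      "\<forall>\<^sub>F k in sequentially. spectrum_at \<nu> k y < spec y + e"
      using * e by (auto intro!: spec_less_imp_eventually)
    then have "\<forall>\<^sub>F k in sequentially. spectrum_at \<nu> k (u *\<^sub>R x + v *\<^sub>R y) \<le> u * spec x + v * spec y + e"
    proof eventually_elim
      case (elim k)
      have "spectrum_at \<nu> k (u *\<^sub>R x + v *\<^sub>R y) \<le> u * spectrum_at \<nu> k x + v * spectrum_at \<nu> k y"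
        using mult_left_mono[OF log_power_sum_convex[of x y u v k], of "1 / real k"] *
        by (simp add: spectrum_at_eq algebra_simps)
      also have "\<dots> \<le> u * (spec x + e) + v * (spec y + e)"
        using elim * by (intro add_mono mult_left_mono) auto
      also have "\<dots> = u * spec x + v * spec y + (u + v) * e" by (simp add: algebra_simps)
      finally show ?case using * by simp
    qed
    then show "spec (u *\<^sub>R x + v *\<^sub>R y) \<le> u * spec x + v * spec y + e"
      using * by (intro eventually_imp_spec_le) auto
  qed
qed simp

lemma slope_tendsto_sigma_minus: "((\<lambda>q. spec q / (q - 1)) \<longlongrightarrow> - sigma_minus \<nu>) (at_right 1)"
  using vector_derivative_at_right_convex[OF convex_on_spec, of 1] by (simp add: spec_1 sigma_minus_def flip: spec_def)

lemma slope_tendsto_sigma_plus: "((\<lambda>q. spec q / (q - 1)) \<longlongrightarrow> - sigma_plus \<nu>) (at_left 1)"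
  using vector_derivative_at_left_convex[OF convex_on_spec, of 1] by (simp add: spec_1 sigma_plus_def flip: spec_def)

text \<open>Left of 1 the spectrum is nonnegative and it vanishes at 1, so the slopes are
  nonpositive. Hence every \<sigma> above \<open>sigma_plus \<nu>\<close> is positive and may be
  divided by.\<close>

lemma sigma_plus_nonneg: "0 \<le> sigma_plus \<nu>"
proof -
  have "\<forall>\<^sub>F q in at_left 1. (0::real) < q \<and> q < 1"
    by (rule eventually_at_leftI[of 0]) auto
  then have "\<forall>\<^sub>F q in at_left 1. spec q / (q - 1) \<le> 0"
    by eventually_elim (simp add: spec_nonneg divide_nonneg_neg)
  then have "- sigma_plus \<nu> \<le> 0"
    by (intro tendsto_upperbound[OF slope_tendsto_sigma_plus]) auto
  then show ?thesis by simp
qed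

lemma ex_power_sum_bound:
  assumes "0 \<le> q" "spec q < r"
  obtains k0 where "\<And>k. k \<ge> k0 \<Longrightarrow> power_sum k q \<le> 2 powr (real k * r)"
proof -
  have "\<forall>\<^sub>F k in sequentially. spectrum_at \<nu> k q < r \<and> 0 < k"
    by (intro eventually_conj spec_less_imp_eventually assms eventually_gt_at_top)
  then obtain k0 where k0: "\<And>k. k \<ge> k0 \<Longrightarrow> spectrum_at \<nu> k q < r \<and> 0 < k"
    by (auto simp: eventually_sequentially)
  have "power_sum k q \<le> 2 powr (real k * r)" if "k \<ge> k0" for k
  proof -
    have "real k * spectrum_at \<nu> k q \<le> real k * r" using k0[OF that] by (intro mult_left_mono) auto
    then have "log 2 (power_sum k q) \<le> real k * r" using k0[OF that] by (simp add: spectrum_at_eq)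
    then show ?thesis using power_sum_pos[OF assms(1), of k] by (simp add: log_le_iff)
  qed
  then show ?thesis by (rule that)
qed

section \<open>From the spectrum to the stopping length\<close>

lemma heavy_mass_le_power_sum:
  assumes "1 < q" "0 < t"
  shows "heavy_mass k t \<le> t powr (1 - q) * power_sum k q"
proof -
  have "heavy_mass k t \<le> (\<Sum>z\<in>heavy k t. t powr (1 - q) * mass k z powr q)"
    unfolding heavy_mass_def
  proof (rule sum_mono)
    fix z assume "z \<in> heavy k t"
    then have z: "t \<le> mass k z" by (simp add: heavy_def)
    have "mass k z = mass k z powr (1 - q) * mass k z powr q"
      using z assms by (simp flip: powr_add)
    \<comment> \<open>The exponent \<open>1 - q\<close> is negative, so the lower bound
      \<open>t\<close> on the mass becomes an upper bound.\<close>
    also have "\<dots> \<le> t powr (1 - q) * mass k z powr q"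
      using z assms by (intro mult_right_mono powr_mono2') auto
    finally show "mass k z \<le> t powr (1 - q) * mass k z powr q" .
  qed
  also have "\<dots> \<le> (\<Sum>z\<in>dyadic_indices k. t powr (1 - q) * mass k z powr q)"
    by (intro sum_mono2) (auto simp: heavy_def)
  finally show ?thesis by (simp add: power_sum_def sum_distrib_left)
qed

text \<open>The complementary light cubes have mass below \<open>t\<close>, and the exponent
  \<open>1 - q\<close> is now positive.\<close>

lemma heavy_mass_ge_power_sum:
  assumes "0 < q" "q < 1" "0 < t"
  shows "1 - t powr (1 - q) * power_sum k q \<le> heavy_mass k t"
proof -
  have "(\<Sum>z\<in>{z \<in> dyadic_indices k. mass k z < t}. mass k z)
      \<le> (\<Sum>z\<in>{z \<in> dyadic_indices k. mass k z < t}. t powr (1 - q) * mass k z powr q)"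
  proof (rule sum_mono)
    fix z assume "z \<in> {z \<in> dyadic_indices k. mass k z < t}"
    then have z: "mass k z < t" by simp
    have "mass k z = mass k z powr (1 - q) * mass k z powr q"
      by (cases "mass k z = 0") (simp_all flip: powr_add)
    also have "\<dots> \<le> t powr (1 - q) * mass k z powr q"
      using z assms by (intro mult_right_mono powr_mono2) auto
    finally show "mass k z \<le> t powr (1 - q) * mass k z powr q" .
  qed
  also have "\<dots> \<le> (\<Sum>z\<in>dyadic_indices k. t powr (1 - q) * mass k z powr q)"
    by (intro sum_mono2) auto
  finally show ?thesis by (simp add: heavy_mass_eq power_sum_def sum_distrib_left)
qed

text \<open>Up to the level \<open>n\<close> where \<open>2 powr (- n * \<sigma>)\<close> drops to
  \<open>t\<close>, each heavy mass is bounded by 1. Beyond it, some \<open>q > 1\<close> whose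
  slope lies below \<open>- \<sigma>\<close> makes the heavy masses decay geometrically.\<close>

lemma stopping_length_upper:
  assumes "0 < \<sigma>" "\<sigma> < sigma_minus \<nu>"
  obtains B where "\<And>t. 0 < t \<Longrightarrow> t \<le> 1 \<Longrightarrow> stopping_length \<nu> t \<le> log 2 (1 / t) / \<sigma> + B"
proof -
  have "\<forall>\<^sub>F q in at_right 1. spec q / (q - 1) < - \<sigma>"
    using order_tendstoD(2)[OF slope_tendsto_sigma_minus] assms by simp
  moreover have "\<forall>\<^sub>F q in at_right 1. (1::real) < q" by (rule eventually_at_right_less)
  ultimately have "\<forall>\<^sub>F q in at_right 1. 1 < q \<and> spec q / (q - 1) < - \<sigma>" by eventually_elim simp
  then obtain q where q: "1 < q" "spec q / (q - 1) < - \<sigma>"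
    using eventually_happens'[OF trivial_limit_at_right_real] by blast
  then have "spec q < - \<sigma> * (q - 1)" by (simp add: divide_less_eq)
  with q obtain k0 where k0: "\<And>k. k \<ge> k0 \<Longrightarrow> power_sum k q \<le> 2 powr (real k * (- \<sigma> * (q - 1)))"
    using ex_power_sum_bound[of q "- \<sigma> * (q - 1)"] by auto
  define r where "r = 2 powr (- \<sigma> * (q - 1))"
  have r: "0 < r" "r < 1" using assms q by (auto simp: r_def powr_less_one mult_neg_pos)
  show ?thesis
  proof (rule that)
    fix t :: real assume t: "0 < t" "t \<le> 1"
    \<comment> \<open>The maximum with \<open>k0\<close> ensures that the power sum bound holds on
      all levels of the tail.\<close>
    define n where "n = max k0 (nat \<lceil>log 2 (1 / t) / \<sigma>\<rceil>)"
    have "log 2 (1 / t) / \<sigma> \<le> real n" unfolding n_def by linarith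
    then have nt: "log 2 (1 / t) \<le> real n * \<sigma>" using assms by (simp add: field_simps)
    have tn: "2 powr (- real n * \<sigma>) \<le> t"
      using nt t by (simp add: log_divide powr_le_iff)
    have step: "heavy_mass (n + j) t \<le> r ^ j" for j
    proof -
      have "heavy_mass (n + j) t \<le> t powr (1 - q) * power_sum (n + j) q"
        by (rule heavy_mass_le_power_sum) (use q t in auto)
      also have "\<dots> \<le> (2 powr (- real n * \<sigma>)) powr (1 - q) * 2 powr (real (n + j) * (- \<sigma> * (q - 1)))"
        using tn q power_sum_pos[of q "n + j"]
        by (intro mult_mono powr_mono2' k0) (auto simp: n_def intro: less_imp_le)
      also have "\<dots> = 2 powr (- real n * \<sigma> * (1 - q) + real (n + j) * (- \<sigma> * (q - 1)))"
        by (simp only: powr_powr powr_add)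
      also have "\<dots> = 2 powr (- \<sigma> * (q - 1) * real j)"
        by (rule arg_cong[where f = "\<lambda>x. 2 powr x"]) (simp add: algebra_simps)
      also have "\<dots> = r ^ j"
        unfolding r_def by (subst powr_power) (auto simp: mult_ac)
      finally show ?thesis .
    qed
    have bound: "(\<Sum>k<n + j. heavy_mass k t) \<le> n + (\<Sum>i<j. r ^ i)" for j
    proof (induction j)
      case 0
      have "(\<Sum>k<n. heavy_mass k t) \<le> (\<Sum>k<n. 1)" by (intro sum_mono heavy_mass_le_1)
      then show ?case by simp
    next
      case (Suc j)
      then show ?case using step[of j] by simp
    qed
    obtain K where K: "C * 2 powr (- a * real K) < t" using ex_decay_level[OF t(1)] by blast
    have "stopping_length \<nu> t = (\<Sum>k<K. heavy_mass k t)" by (rule stopping_length_eq[OF t(1) K])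
    also have "\<dots> \<le> (\<Sum>k<n + K. heavy_mass k t)" by (intro sum_mono2) (auto simp: heavy_mass_nonneg)
    also have "\<dots> \<le> n + (\<Sum>i<K. r ^ i)" by (rule bound)
    also have "(\<Sum>i<K. r ^ i) \<le> (\<Sum>i. r ^ i)" using r by (intro sum_le_suminf summable_geometric) auto
    also have "\<dots> = 1 / (1 - r)" using r by (intro suminf_geometric) auto
    also have "real n \<le> log 2 (1 / t) / \<sigma> + 1 + real k0"
    proof -
      have "0 \<le> log 2 (1 / t) / \<sigma>" using t assms by simp
      then show ?thesis unfolding n_def by linarith
    qed
    finally show "stopping_length \<nu> t \<le> log 2 (1 / t) / \<sigma> + (1 + real k0 + 1 / (1 - r))" by simp
  qed
qed

text \<open>Mirror image of the upper bound: for some \<open>q < 1\<close> the light mass at level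
  \<open>k\<close>, for \<open>k0 \<le> k < n\<close>, is at most \<open>r ^ (n - k)\<close>, so
  almost all of the first \<open>n\<close> levels count fully.\<close>

lemma stopping_length_lower:
  assumes "sigma_plus \<nu> < \<sigma>"
  obtains B where "\<And>t. 0 < t \<Longrightarrow> t \<le> 1 \<Longrightarrow> log 2 (1 / t) / \<sigma> - B \<le> stopping_length \<nu> t"
proof -
  have \<sigma>: "0 < \<sigma>" using assms sigma_plus_nonneg by simp
  have "\<forall>\<^sub>F q in at_left 1. - \<sigma> < spec q / (q - 1)"
    using order_tendstoD(1)[OF slope_tendsto_sigma_plus] assms by simp
  moreover have "\<forall>\<^sub>F q in at_left 1. (0::real) < q \<and> q < 1"
    by (rule eventually_at_leftI[of 0]) auto
  ultimately have "\<forall>\<^sub>F q in at_left 1. (0 < q \<and> q < 1) \<and> - \<sigma> < spec q / (q - 1)" by eventually_elim simp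
  then obtain q where q: "0 < q" "q < 1" "- \<sigma> < spec q / (q - 1)"
    using eventually_happens'[OF trivial_limit_at_left_real] by blast
  then have "spec q < \<sigma> * (1 - q)" by (simp add: less_divide_eq algebra_simps)
  with q obtain k0 where k0: "\<And>k. k \<ge> k0 \<Longrightarrow> power_sum k q \<le> 2 powr (real k * (\<sigma> * (1 - q)))"
    using ex_power_sum_bound[of q "\<sigma> * (1 - q)"] by auto
  define r where "r = 2 powr (- \<sigma> * (1 - q))"
  have r: "0 < r" "r < 1" using \<sigma> q by (auto simp: r_def powr_less_one mult_neg_pos)
  show ?thesis
  proof (rule that)
    fix t :: real assume t: "0 < t" "t \<le> 1"
    define n where "n = nat \<lfloor>log 2 (1 / t) / \<sigma>\<rfloor>"
    have L0: "0 \<le> log 2 (1 / t) / \<sigma>" using t \<sigma> by simp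
    then have n: "real n \<le> log 2 (1 / t) / \<sigma>" "log 2 (1 / t) / \<sigma> - 1 \<le> real n"
      unfolding n_def by linarith+
    then have nt: "real n * \<sigma> \<le> log 2 (1 / t)" using \<sigma> by (simp add: field_simps)
    have tn: "t \<le> 2 powr (- real n * \<sigma>)"
      using nt t by (simp add: log_divide le_powr_iff)
    \<comment> \<open>The indicator makes the claim trivial on the finitely many levels below
      \<open>k0\<close>, where no power sum bound is available.\<close>
    have step: "1 - r ^ (n - k) - of_bool (k < k0) \<le> heavy_mass k t" if "k < n" for k
    proof (cases "k < k0")
      case True
      moreover have "0 \<le> r ^ (n - k)" using r by simp
      ultimately show ?thesis using heavy_mass_nonneg[of k t] by simp
    next
      case False
      have "t powr (1 - q) * power_sum k q \<le> (2 powr (- real n * \<sigma>)) powr (1 - q) * 2 powr (real k * (\<sigma> * (1 - q)))"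
        using tn q t False by (intro mult_mono powr_mono2 k0) (auto simp: power_sum_pos less_imp_le)
      also have "\<dots> = 2 powr (- real n * \<sigma> * (1 - q) + real k * (\<sigma> * (1 - q)))"
        by (simp only: powr_powr powr_add)
      also have "\<dots> = 2 powr (- \<sigma> * (1 - q) * real (n - k))"
        by (rule arg_cong[where f = "\<lambda>x. 2 powr x"]) (use that in \<open>simp add: algebra_simps of_nat_diff\<close>)
      also have "\<dots> = r ^ (n - k)"
        unfolding r_def by (subst powr_power) (auto simp: mult_ac)
      finally show ?thesis using heavy_mass_ge_power_sum[OF q(1,2) t(1), of k] False by simp
    qed
    have "(\<Sum>k<n. r ^ (n - k)) = (\<Sum>k<n. r ^ Suc (n - Suc k))"
      by (intro sum.cong) (auto simp: Suc_diff_Suc simp del: power_Suc)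
    also have "\<dots> = (\<Sum>k<n. r ^ Suc k)" by (rule sum.nat_diff_reindex)
    also have "\<dots> \<le> (\<Sum>k<n. r ^ k)" using r by (intro sum_mono) (simp add: mult_left_le_one_le)
    also have "\<dots> \<le> (\<Sum>k. r ^ k)" using r by (intro sum_le_suminf summable_geometric) auto
    also have "\<dots> = 1 / (1 - r)" using r by (intro suminf_geometric) auto
    finally have geo: "(\<Sum>k<n. r ^ (n - k)) \<le> 1 / (1 - r)" .
    have "(\<Sum>k<n. of_bool (k < k0)) = real (card ({..<n} \<inter> {..<k0}))"
      by (simp add: of_bool_def sum.If_cases lessThan_def)
    also have "\<dots> \<le> real k0" using card_mono[of "{..<k0}" "{..<n} \<inter> {..<k0}"] by simp
    finally have init: "(\<Sum>k<n. of_bool (k < k0)) \<le> real k0" .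
    have "real n - 1 / (1 - r) - real k0 \<le> (\<Sum>k<n. 1 - r ^ (n - k) - of_bool (k < k0))"
      using geo init by (simp add: sum_subtractf)
    also have "\<dots> \<le> (\<Sum>k<n. heavy_mass k t)" by (intro sum_mono step) simp
    also have "\<dots> \<le> stopping_length \<nu> t" by (rule sum_heavy_mass_le[OF t(1)])
    finally show "log 2 (1 / t) / \<sigma> - (1 + 1 / (1 - r) + real k0) \<le> stopping_length \<nu> t"
      using n by linarith
  qed
qed

end

subsection \<open>Comparison of the limits\<close>

context dyadic_decay
begin

definition dim_ratio :: "real \<Rightarrow> real" where
  "dim_ratio t = log 2 (1 / t) / stopping_length \<nu> t"

definition quant_ratio :: "nat \<Rightarrow> real" where
  "quant_ratio N = log 2 (real N) / - log 2 (quant_error0 \<nu> N)"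

lemma eventually_at_right_0_unit: "\<forall>\<^sub>F t in at_right 0. 0 < t \<and> t < (1::real)"
  by (rule eventually_at_rightI[of 0 1]) auto

lemma filterlim_powr_at_right_0: "0 < c \<Longrightarrow> filterlim (\<lambda>N. real N powr - c) (at_right 0) sequentially"
  by real_asymp

lemma dim_ratio_nonneg: "0 < t \<Longrightarrow> t \<le> 1 \<Longrightarrow> 0 \<le> dim_ratio t"
  unfolding dim_ratio_def using stopping_length_ge_1[of t] by (intro divide_nonneg_nonneg) auto

lemma dim_ratio_powr: "0 < N \<Longrightarrow> dim_ratio (real N powr - c) = c * log 2 N / stopping_length \<nu> (real N powr - c)"
proof -
  assume "0 < N"
  have "1 / (real N powr - c) = real N powr c" by (simp add: powr_minus divide_inverse)
  with \<open>0 < N\<close> show ?thesis unfolding dim_ratio_def by (simp add: log_powr)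
qed

section \<open>Sampling along negative powers of integers\<close>

lemma liminf_dim_ratio_powr:
  assumes c: "0 < c"
  shows "liminf (\<lambda>N. ereal (dim_ratio (real N powr - c))) = Liminf (at_right 0) (\<lambda>t. ereal (dim_ratio t))"
proof (rule antisym)
  show "Liminf (at_right 0) (\<lambda>t. ereal (dim_ratio t)) \<le> liminf (\<lambda>N. ereal (dim_ratio (real N powr - c)))"
    by (rule Liminf_filterlim_le[OF filterlim_powr_at_right_0[OF c]])
  show "liminf (\<lambda>N. ereal (dim_ratio (real N powr - c))) \<le> Liminf (at_right 0) (\<lambda>t. ereal (dim_ratio t))"
  proof (rule le_Liminf_approx)
    show "\<forall>\<^sub>F t in at_right 0. 0 \<le> dim_ratio t"
      using eventually_at_right_0_unit by eventually_elim (simp add: dim_ratio_nonneg)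
    fix \<kappa> :: real assume \<kappa>: "1 < \<kappa>"
    \<comment> \<open>Solving \<open>t = s powr - c\<close> and rounding \<open>s\<close> up
      decreases the parameter, so the stopping length grows, while the numerator grows by a factor
      of at most \<open>\<kappa>\<close>. The ratio at the sample is thus at most
      \<open>\<kappa>\<close> times the ratio at \<open>t\<close>.\<close>
    define s where "s t = t powr - (1 / c)" for t
    have s: "filterlim s at_top (at_right 0)" unfolding s_def using c by real_asymp
    define n where "n t = nat \<lceil>s t\<rceil>" for t
    have n: "filterlim n sequentially (at_right 0)"
      unfolding filterlim_at_top
    proof
      fix Z :: nat
      have "\<forall>\<^sub>F t in at_right 0. real Z + 1 \<le> s t" using s by (simp add: filterlim_at_top)
      then show "\<forall>\<^sub>F t in at_right 0. Z \<le> n t" unfolding n_def by eventually_elim linarith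
    qed
    have "\<forall>\<^sub>F x in at_top. log 2 (x + 1) \<le> \<kappa> * log 2 x \<and> 1 < x"
      using \<kappa> by (intro eventually_conj) real_asymp+
    from eventually_compose_filterlim[OF this s]
    have "\<forall>\<^sub>F t in at_right 0. dim_ratio (real (n t) powr - c) \<le> \<kappa> * dim_ratio t"
      using eventually_at_right_0_unit
    proof eventually_elim
      case (elim t)
      have s1: "1 < s t" using elim by simp
      have nt: "s t \<le> real (n t)" "real (n t) \<le> s t + 1" "0 < n t" using s1 unfolding n_def by linarith+
      have st: "s t powr - c = t" using elim c by (simp add: s_def powr_powr)
      have "real (n t) powr - c \<le> s t powr - c" using nt s1 c by (intro powr_mono2') auto
      then have le: "real (n t) powr - c \<le> t" by (simp add: st)
      have L: "0 < stopping_length \<nu> t" "stopping_length \<nu> t \<le> stopping_length \<nu> (real (n t) powr - c)"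
        using elim stopping_length_ge_1[of t] nt by (auto intro!: stopping_length_antimono le)
      have "log 2 (1 / t) = c * log 2 (s t)"
        using elim c by (simp add: s_def log_powr log_divide)
      then have "c * log 2 (real (n t)) \<le> \<kappa> * log 2 (1 / t)"
      proof -
        have "log 2 (real (n t)) \<le> log 2 (s t + 1)" using nt s1 by simp
        also have "\<dots> \<le> \<kappa> * log 2 (s t)" using elim by simp
        finally show ?thesis using c \<open>log 2 (1 / t) = c * log 2 (s t)\<close> by (simp add: mult.left_commute)
      qed
      then show ?case
        using L nt elim \<kappa> unfolding dim_ratio_powr[OF nt(3)] dim_ratio_def[of t] times_divide_eq_right
        by (intro frac_le) auto
    qed
    moreover have "liminf (\<lambda>N. ereal (dim_ratio (real N powr - c)))
        \<le> Liminf (at_right 0) (\<lambda>t. ereal (dim_ratio (real (n t) powr - c)))"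
      by (rule Liminf_filterlim_le[OF n])
    ultimately show "\<exists>v. liminf (\<lambda>N. ereal (dim_ratio (real N powr - c)))
        \<le> Liminf (at_right 0) (\<lambda>t. ereal (v t)) \<and> (\<forall>\<^sub>F t in at_right 0. v t \<le> \<kappa> * dim_ratio t)"
      by (intro exI[of _ "\<lambda>t. dim_ratio (real (n t) powr - c)"] conjI)
  qed simp
qed

lemma limsup_dim_ratio_powr:
  assumes c: "0 < c"
  shows "limsup (\<lambda>N. ereal (dim_ratio (real N powr - c))) = Limsup (at_right 0) (\<lambda>t. ereal (dim_ratio t))"
proof (rule antisym)
  show "limsup (\<lambda>N. ereal (dim_ratio (real N powr - c))) \<le> Limsup (at_right 0) (\<lambda>t. ereal (dim_ratio t))"
    by (rule Limsup_filterlim_ge[OF filterlim_powr_at_right_0[OF c]])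
  show "Limsup (at_right 0) (\<lambda>t. ereal (dim_ratio t)) \<le> limsup (\<lambda>N. ereal (dim_ratio (real N powr - c)))"
  proof (rule Limsup_le_approx)
    have "\<forall>\<^sub>F N in sequentially. (1::nat) \<le> N" by (rule eventually_ge_at_top)
    then have "\<forall>\<^sub>F N in sequentially. 0 \<le> dim_ratio (real N powr - c)"
      by eventually_elim (use c in \<open>auto intro!: dim_ratio_nonneg powr_le_one_le simp: powr_minus inverse_le_1_iff ge_one_powr_ge_zero\<close>)
    then show "0 \<le> limsup (\<lambda>N. ereal (dim_ratio (real N powr - c)))"
      by (intro le_Limsup) (auto elim: eventually_mono)
    fix \<kappa> :: real assume \<kappa>: "1 < \<kappa>"
    define s where "s t = t powr - (1 / c)" for t
    have s: "filterlim s at_top (at_right 0)" unfolding s_def using c by real_asymp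
    \<comment> \<open>Rounding down now increases the parameter and lowers the stopping length, as
      the opposite comparison demands.\<close>
    define n where "n t = nat \<lfloor>s t\<rfloor>" for t
    have n: "filterlim n sequentially (at_right 0)"
      unfolding filterlim_at_top
    proof
      fix Z :: nat
      have "\<forall>\<^sub>F t in at_right 0. real Z + 1 \<le> s t" using s by (simp add: filterlim_at_top)
      then show "\<forall>\<^sub>F t in at_right 0. Z \<le> n t" unfolding n_def by eventually_elim linarith
    qed
    have "\<forall>\<^sub>F x in at_top. log 2 x \<le> \<kappa> * log 2 (x - 1) \<and> 2 < x"
      using \<kappa> by (intro eventually_conj) real_asymp+
    from eventually_compose_filterlim[OF this s]
    have "\<forall>\<^sub>F t in at_right 0. dim_ratio t \<le> \<kappa> * dim_ratio (real (n t) powr - c)"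
      using eventually_at_right_0_unit
    proof eventually_elim
      case (elim t)
      have s1: "2 < s t" using elim by simp
      have nt: "real (n t) \<le> s t" "s t - 1 \<le> real (n t)" "0 < n t" using s1 unfolding n_def by linarith+
      have st: "s t powr - c = t" using elim c by (simp add: s_def powr_powr)
      have "s t powr - c \<le> real (n t) powr - c" using nt s1 c by (intro powr_mono2') auto
      then have le: "t \<le> real (n t) powr - c" by (simp add: st)
      have "real (n t) powr - c \<le> 1"
        using nt(3) c by (auto simp: powr_minus inverse_le_1_iff ge_one_powr_ge_zero)
      then have L: "0 < stopping_length \<nu> (real (n t) powr - c)"
          "stopping_length \<nu> (real (n t) powr - c) \<le> stopping_length \<nu> t"
        using elim stopping_length_ge_1[of "real (n t) powr - c"] nt by (auto intro!: stopping_length_antimono le)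
      have eq: "log 2 (1 / t) = c * log 2 (s t)"
        using elim c by (simp add: s_def log_powr log_divide)
      have "log 2 (s t) \<le> \<kappa> * log 2 (s t - 1)" using elim by simp
      also have "\<dots> \<le> \<kappa> * log 2 (real (n t))" using nt s1 \<kappa> by (intro mult_left_mono) auto
      finally have "log 2 (1 / t) \<le> \<kappa> * (c * log 2 (real (n t)))"
        using c by (simp add: eq mult.left_commute)
      moreover have "0 \<le> \<kappa> * (c * log 2 (real (n t)))" using \<kappa> c nt(3) by simp
      ultimately show ?case
        using L nt elim \<kappa> unfolding dim_ratio_powr[OF nt(3)] dim_ratio_def[of t] times_divide_eq_right
        by (intro frac_le) auto
    qed
    moreover have "Limsup (at_right 0) (\<lambda>t. ereal (dim_ratio (real (n t) powr - c)))
        \<le> limsup (\<lambda>N. ereal (dim_ratio (real N powr - c)))"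
      by (rule Limsup_filterlim_ge[OF n])
    ultimately show "\<exists>v. Limsup (at_right 0) (\<lambda>t. ereal (v t))
        \<le> limsup (\<lambda>N. ereal (dim_ratio (real N powr - c))) \<and> (\<forall>\<^sub>F t in at_right 0. dim_ratio t \<le> \<kappa> * v t)"
      by (intro exI[of _ "\<lambda>t. dim_ratio (real (n t) powr - c)"] conjI)
  qed simp
qed

section \<open>Quantization error against stopping length\<close>

lemma eventually_neg_log_quant_error0_ge:
  assumes "0 < \<theta>" "\<theta> < 1"
  shows "\<forall>\<^sub>F N in sequentially. stopping_length \<nu> (real N powr - \<theta>) - 1 \<le> - log 2 (quant_error0 \<nu> N)"
proof -
  \<comment> \<open>\<open>A + B * log 2 N\<close> bounds the number \<open>K\<close> of levels that
    the decay requires for \<open>t = N powr - \<theta>\<close>. Since \<open>\<theta> < 1\<close>,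
    the resulting \<open>K / t\<close> points eventually fit into \<open>N\<close>.\<close>
  define A B where "A = log 2 C / a + 1" and "B = \<theta> / a"
  have AB: "0 < A" "0 < B" using a_pos C_ge assms by (auto simp: A_def B_def add_nonneg_pos)
  have "\<forall>\<^sub>F N in sequentially. (A + B * log 2 (real N)) * real N powr \<theta> \<le> real N"
    using AB assms by real_asymp
  with eventually_ge_at_top[of 1] show ?thesis
  proof eventually_elim
    case (elim N)
    define x where "x = (log 2 C + \<theta> * log 2 (real N)) / a"
    have x0: "0 \<le> x" using elim C_ge a_pos assms by (simp add: x_def)
    define K where "K = nat \<lfloor>x\<rfloor> + 1"
    have K: "x < real K" "real K \<le> x + 1" using x0 unfolding K_def by linarith+
    show ?case
    proof (rule neg_log_quant_error0_ge)
      show "real N powr - \<theta> \<le> 1"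
        using elim assms by (auto simp: powr_minus inverse_le_1_iff ge_one_powr_ge_zero)
      have "log 2 C + \<theta> * log 2 (real N) < a * real K" using K(1) a_pos by (simp add: x_def field_simps)
      then have "log 2 C + - a * real K < - \<theta> * log 2 (real N)" by simp
      then have "log 2 (C * 2 powr (- a * real K)) < log 2 (real N powr - \<theta>)"
        using C_ge elim by (subst log_mult) (auto simp: log_powr)
      then show "C * 2 powr (- a * real K) < real N powr - \<theta>"
        using C_ge elim by (subst (asm) log_less_cancel_iff) auto
      have "real K / real N powr - \<theta> = real K * real N powr \<theta>" by (simp add: powr_minus divide_inverse)
      also have "\<dots> \<le> (A + B * log 2 (real N)) * real N powr \<theta>"
        using K(2) by (intro mult_right_mono) (auto simp: x_def A_def B_def add_divide_distrib)
      also have "\<dots> \<le> real N" by (rule elim)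
      finally show "real K / real N powr - \<theta> \<le> real N" .
    qed (use elim in simp)
  qed
qed

lemma filterlim_stopping_length_powr:
  "0 < c \<Longrightarrow> filterlim (\<lambda>N. stopping_length \<nu> (real N powr - c)) at_top sequentially"
  by (rule filterlim_compose[OF filterlim_stopping_length filterlim_powr_at_right_0])

lemma eventually_quant_error0_neg: "\<forall>\<^sub>F N in sequentially. 0 < - log 2 (quant_error0 \<nu> N)"
  using eventually_neg_log_quant_error0_ge[of "1 / 2", simplified]
    filterlim_stopping_length_powr[of "1 / 2", simplified, unfolded filterlim_at_top_dense, rule_format, of 1]
  by eventually_elim simp

lemma eventually_quant_ratio_nonneg: "\<forall>\<^sub>F N in sequentially. 0 \<le> quant_ratio N"
  using eventually_quant_error0_neg eventually_ge_at_top[of 1]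
  by eventually_elim (auto simp: quant_ratio_def intro!: divide_nonneg_neg)

text \<open>The factor \<open>\<kappa>\<close> is split into two equal factors \<open>r\<close>: one
  pays for the exponent \<open>\<theta> = 1 / r\<close> instead of 1, the other absorbs the loss of
  1 in the unbounded stopping length.\<close>

lemma eventually_quant_ratio_le:
  assumes "1 < \<kappa>"
  shows "\<exists>\<theta>>0. \<forall>\<^sub>F N in sequentially. quant_ratio N \<le> \<kappa> * dim_ratio (real N powr - \<theta>)"
proof -
  define r where "r = sqrt \<kappa>"
  have r: "1 < r" "r * r = \<kappa>" using assms by (auto simp: r_def)
  define \<theta> where "\<theta> = 1 / r"
  have \<theta>: "0 < \<theta>" "\<theta> < 1" using r by (auto simp: \<theta>_def)
  have "\<forall>\<^sub>F N in sequentially. r / (r - 1) < stopping_length \<nu> (real N powr - \<theta>)"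
    using filterlim_stopping_length_powr[OF \<theta>(1)] unfolding filterlim_at_top_dense by blast
  with eventually_neg_log_quant_error0_ge[OF \<theta>] eventually_ge_at_top[of 1]
  have "\<forall>\<^sub>F N in sequentially. quant_ratio N \<le> \<kappa> * dim_ratio (real N powr - \<theta>)"
  proof eventually_elim
    case (elim N)
    define L where "L = stopping_length \<nu> (real N powr - \<theta>)"
    have "0 < r / (r - 1)" "r / (r - 1) < L" using r elim by (auto simp: L_def)
    then have L: "0 < L" "L / r \<le> L - 1" using r by (linarith, simp add: field_simps)
    have pos: "0 < L / r" using L r by simp
    have "L / r \<le> - log 2 (quant_error0 \<nu> N)" using elim L by (simp add: L_def)
    with pos have "quant_ratio N \<le> log 2 (real N) / (L / r)"
      unfolding quant_ratio_def using elim by (intro divide_left_mono mult_pos_pos) auto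
    also have "\<dots> = \<kappa> * (\<theta> * log 2 (real N) / L)" using r L by (simp add: \<theta>_def flip: r(2))
    also have "\<dots> = \<kappa> * dim_ratio (real N powr - \<theta>)"
      using elim by (subst dim_ratio_powr) (auto simp: L_def)
    finally show ?case .
  qed
  with \<theta>(1) show ?thesis by blast
qed

lemma eventually_quant_ratio_ge:
  assumes "1 < \<kappa>"
  shows "\<exists>\<theta>>0. \<forall>\<^sub>F N in sequentially. dim_ratio (real N powr - \<theta>) \<le> \<kappa> * quant_ratio N"
proof -
  define r where "r = sqrt \<kappa>"
  have r: "1 < r" "r * r = \<kappa>" using assms by (auto simp: r_def)
  \<comment> \<open>This makes the exponent \<open>1 / (1 - \<delta>)\<close> equal to
    \<open>r\<close>, which costs one factor \<open>r\<close>. The constant \<open>B\<close> is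
    fixed once \<open>\<delta>\<close> is, so the other factor absorbs it for large
    \<open>N\<close>.\<close>
  define \<delta> where "\<delta> = 1 - 1 / r"
  have \<delta>: "0 < \<delta>" "\<delta> < 1" "1 / (1 - \<delta>) = r" using r by (auto simp: \<delta>_def)
  define B where "B = 5 ^ CARD('n) * C powr \<delta> / (1 - 2 powr (- a * \<delta>))"
  have "0 < r" using r by simp
  then have "\<forall>\<^sub>F N in sequentially. max 0 (B / (r - 1)) < stopping_length \<nu> (real N powr - r)"
    using filterlim_stopping_length_powr[of r] unfolding filterlim_at_top_dense by blast
  with eventually_quant_error0_neg eventually_ge_at_top[of 1]
  have "\<forall>\<^sub>F N in sequentially. dim_ratio (real N powr - r) \<le> \<kappa> * quant_ratio N"
  proof eventually_elim
    case (elim N)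
    define L where "L = stopping_length \<nu> (real N powr - r)"
    have "0 < L" "B / (r - 1) < L" using elim by (simp_all add: L_def)
    then have L: "0 < L" "L + B \<le> r * L" using r by (simp_all add: divide_less_eq algebra_simps)
    have "- log 2 (quant_error0 \<nu> N) \<le> L + B"
      using neg_log_quant_error0_le[of N \<delta>] elim \<delta> by (simp add: L_def B_def)
    then have le: "- log 2 (quant_error0 \<nu> N) \<le> r * L" using L by simp
    have "dim_ratio (real N powr - r) = r * log 2 (real N) / L"
      using elim by (subst dim_ratio_powr) (auto simp: L_def)
    also have "\<dots> = \<kappa> * (log 2 (real N) / (r * L))" using r L by (simp flip: r(2))
    also have "\<dots> \<le> \<kappa> * quant_ratio N"
      unfolding quant_ratio_def using elim L r le assms
      by (intro mult_left_mono divide_left_mono mult_pos_pos) auto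
    finally show ?case .
  qed
  with \<open>0 < r\<close> show ?thesis by blast
qed

lemma Liminf_dim_ratio_nonneg: "0 \<le> Liminf (at_right 0) (\<lambda>t. ereal (dim_ratio t))"
  by (intro Liminf_bounded eventually_mono[OF eventually_at_right_0_unit]) (simp add: dim_ratio_nonneg)

lemma Limsup_dim_ratio_nonneg: "0 \<le> Limsup (at_right 0) (\<lambda>t. ereal (dim_ratio t))"
  by (rule order_trans[OF Liminf_dim_ratio_nonneg Liminf_le_Limsup]) simp

text \<open>The two comparisons change the exponent \<open>\<theta>\<close> with
  \<open>\<kappa>\<close>, but the lower limit of \<open>dim_ratio\<close> along
  \<open>N powr - \<theta>\<close> is the same for every positive \<open>\<theta>\<close>.\<close>

lemma lower_quant_dim0_eq: "lower_quant_dim0 \<nu> = Liminf (at_right 0) (\<lambda>t. ereal (dim_ratio t))"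
  unfolding lower_quant_dim0_def quant_ratio_def[symmetric]
proof (rule antisym)
  show "liminf (\<lambda>N. ereal (quant_ratio N)) \<le> Liminf (at_right 0) (\<lambda>t. ereal (dim_ratio t))"
  proof (rule Liminf_le_approx)
    fix \<kappa> :: real assume "1 < \<kappa>"
    from eventually_quant_ratio_le[OF this] obtain \<theta> where "0 < \<theta>"
      and "\<forall>\<^sub>F N in sequentially. quant_ratio N \<le> \<kappa> * dim_ratio (real N powr - \<theta>)" by blast
    then show "\<exists>v. liminf (\<lambda>N. ereal (v N)) \<le> Liminf (at_right 0) (\<lambda>t. ereal (dim_ratio t)) \<and>
        (\<forall>\<^sub>F N in sequentially. quant_ratio N \<le> \<kappa> * v N)"
      by (intro exI[of _ "\<lambda>N. dim_ratio (real N powr - \<theta>)"]) (simp add: liminf_dim_ratio_powr)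
  qed (simp_all add: Liminf_dim_ratio_nonneg)
  show "Liminf (at_right 0) (\<lambda>t. ereal (dim_ratio t)) \<le> liminf (\<lambda>N. ereal (quant_ratio N))"
  proof (rule le_Liminf_approx)
    fix \<kappa> :: real assume "1 < \<kappa>"
    from eventually_quant_ratio_ge[OF this] obtain \<theta> where "0 < \<theta>"
      and "\<forall>\<^sub>F N in sequentially. dim_ratio (real N powr - \<theta>) \<le> \<kappa> * quant_ratio N" by blast
    then show "\<exists>v. Liminf (at_right 0) (\<lambda>t. ereal (dim_ratio t)) \<le> liminf (\<lambda>N. ereal (v N)) \<and>
        (\<forall>\<^sub>F N in sequentially. v N \<le> \<kappa> * quant_ratio N)"
      by (intro exI[of _ "\<lambda>N. dim_ratio (real N powr - \<theta>)"]) (simp add: liminf_dim_ratio_powr)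
  qed (simp_all add: eventually_quant_ratio_nonneg)
qed

lemma upper_quant_dim0_eq: "upper_quant_dim0 \<nu> = Limsup (at_right 0) (\<lambda>t. ereal (dim_ratio t))"
  unfolding upper_quant_dim0_def quant_ratio_def[symmetric]
proof (rule antisym)
  show "limsup (\<lambda>N. ereal (quant_ratio N)) \<le> Limsup (at_right 0) (\<lambda>t. ereal (dim_ratio t))"
  proof (rule Limsup_le_approx)
    fix \<kappa> :: real assume "1 < \<kappa>"
    from eventually_quant_ratio_le[OF this] obtain \<theta> where "0 < \<theta>"
      and "\<forall>\<^sub>F N in sequentially. quant_ratio N \<le> \<kappa> * dim_ratio (real N powr - \<theta>)" by blast
    then show "\<exists>v. limsup (\<lambda>N. ereal (v N)) \<le> Limsup (at_right 0) (\<lambda>t. ereal (dim_ratio t)) \<and>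
        (\<forall>\<^sub>F N in sequentially. quant_ratio N \<le> \<kappa> * v N)"
      by (intro exI[of _ "\<lambda>N. dim_ratio (real N powr - \<theta>)"]) (simp add: limsup_dim_ratio_powr)
  qed (simp_all add: Limsup_dim_ratio_nonneg)
  show "Limsup (at_right 0) (\<lambda>t. ereal (dim_ratio t)) \<le> limsup (\<lambda>N. ereal (quant_ratio N))"
  proof (rule le_Limsup_approx)
    fix \<kappa> :: real assume "1 < \<kappa>"
    from eventually_quant_ratio_ge[OF this] obtain \<theta> where "0 < \<theta>"
      and "\<forall>\<^sub>F N in sequentially. dim_ratio (real N powr - \<theta>) \<le> \<kappa> * quant_ratio N" by blast
    then show "\<exists>v. Limsup (at_right 0) (\<lambda>t. ereal (dim_ratio t)) \<le> limsup (\<lambda>N. ereal (v N)) \<and>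
        (\<forall>\<^sub>F N in sequentially. v N \<le> \<kappa> * quant_ratio N)"
      by (intro exI[of _ "\<lambda>N. dim_ratio (real N powr - \<theta>)"]) (simp add: limsup_dim_ratio_powr)
  qed (simp_all add: eventually_quant_ratio_nonneg)
qed

section \<open>Bounds by the one-sided derivatives of the spectrum\<close>

lemma sigma_minus_le_Liminf: "ereal (sigma_minus \<nu>) \<le> Liminf (at_right 0) (\<lambda>t. ereal (dim_ratio t))"
proof (rule ereal_le_epsilon2)
  fix e :: real assume e: "0 < e"
  define \<sigma> where "\<sigma> = sigma_minus \<nu> - e"
  have "ereal \<sigma> \<le> Liminf (at_right 0) (\<lambda>t. ereal (dim_ratio t))"
  proof (cases "0 < \<sigma>")
    case True
    obtain B where B: "\<And>t. 0 < t \<Longrightarrow> t \<le> 1 \<Longrightarrow> stopping_length \<nu> t \<le> log 2 (1 / t) / \<sigma> + B"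
      using stopping_length_upper[OF True] e by (auto simp: \<sigma>_def)
    show ?thesis
    proof (rule le_Liminf_approx)
      show "\<forall>\<^sub>F t in at_right 0. 0 \<le> dim_ratio t"
        using eventually_at_right_0_unit by eventually_elim (simp add: dim_ratio_nonneg)
      fix \<kappa> :: real assume \<kappa>: "1 < \<kappa>"
      \<comment> \<open>The additive constant is absorbed because \<open>log 2 (1 / t)\<close> is
        unbounded.\<close>
      have "\<forall>\<^sub>F t in at_right 0. log 2 (1 / t) + \<sigma> * B \<le> \<kappa> * log 2 (1 / t)"
        using \<kappa> by real_asymp
      with eventually_at_right_0_unit have "\<forall>\<^sub>F t in at_right 0. \<sigma> \<le> \<kappa> * dim_ratio t"
      proof eventually_elim
        case (elim t)
        have "\<sigma> * stopping_length \<nu> t \<le> log 2 (1 / t) + \<sigma> * B"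
          using mult_left_mono[OF B[of t], of \<sigma>] elim True by (simp add: distrib_left)
        also have "\<dots> \<le> \<kappa> * log 2 (1 / t)" by (rule elim)
        finally show ?case using stopping_length_ge_1[of t] elim
          by (simp add: dim_ratio_def le_divide_eq)
      qed
      then show "\<exists>v. ereal \<sigma> \<le> Liminf (at_right 0) (\<lambda>t. ereal (v t)) \<and>
          (\<forall>\<^sub>F t in at_right 0. v t \<le> \<kappa> * dim_ratio t)"
        by (intro exI[of _ "\<lambda>_. \<sigma>"]) (simp add: Liminf_const)
    qed simp
  next
    case False
    then have "ereal \<sigma> \<le> 0" by simp
    then show ?thesis using Liminf_dim_ratio_nonneg by (rule order_trans)
  qed
  then have "ereal \<sigma> + ereal e \<le> Liminf (at_right 0) (\<lambda>t. ereal (dim_ratio t)) + ereal e"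
    by (rule add_right_mono)
  then show "ereal (sigma_minus \<nu>) \<le> Liminf (at_right 0) (\<lambda>t. ereal (dim_ratio t)) + ereal e"
    by (simp add: \<sigma>_def)
qed

lemma Limsup_le_sigma_plus: "Limsup (at_right 0) (\<lambda>t. ereal (dim_ratio t)) \<le> ereal (sigma_plus \<nu>)"
proof (rule ereal_le_epsilon2)
  fix e :: real assume e: "0 < e"
  define \<sigma> where "\<sigma> = sigma_plus \<nu> + e"
  have \<sigma>: "0 < \<sigma>" using e sigma_plus_nonneg by (simp add: \<sigma>_def)
  obtain B where B: "\<And>t. 0 < t \<Longrightarrow> t \<le> 1 \<Longrightarrow> log 2 (1 / t) / \<sigma> - B \<le> stopping_length \<nu> t"
    using stopping_length_lower[of \<sigma>] e by (auto simp: \<sigma>_def)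
  have "Limsup (at_right 0) (\<lambda>t. ereal (dim_ratio t)) \<le> ereal \<sigma>"
  proof (rule Limsup_le_approx)
    fix \<kappa> :: real assume \<kappa>: "1 < \<kappa>"
    \<comment> \<open>Beyond this threshold \<open>B\<close> is at most
      \<open>(\<kappa> - 1)\<close> times the stopping length.\<close>
    have "\<forall>\<^sub>F t in at_right 0. B / (\<kappa> - 1) < stopping_length \<nu> t"
      using filterlim_stopping_length unfolding filterlim_at_top_dense by blast
    with eventually_at_right_0_unit have "\<forall>\<^sub>F t in at_right 0. dim_ratio t \<le> \<kappa> * \<sigma>"
    proof eventually_elim
      case (elim t)
      have "log 2 (1 / t) / \<sigma> \<le> stopping_length \<nu> t + B" using B[of t] elim by simp
      also have "\<dots> \<le> \<kappa> * stopping_length \<nu> t" using elim \<kappa> by (simp add: field_simps)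
      finally have "log 2 (1 / t) \<le> \<kappa> * \<sigma> * stopping_length \<nu> t"
        using \<sigma> by (simp add: divide_le_eq mult_ac)
      then show ?case using stopping_length_ge_1[of t] elim
        by (simp add: dim_ratio_def divide_le_eq)
    qed
    then show "\<exists>v. Limsup (at_right 0) (\<lambda>t. ereal (v t)) \<le> ereal \<sigma> \<and>
        (\<forall>\<^sub>F t in at_right 0. dim_ratio t \<le> \<kappa> * v t)"
      by (intro exI[of _ "\<lambda>_. \<sigma>"]) (simp add: Limsup_const)
  qed (use \<sigma> in auto)
  then show "Limsup (at_right 0) (\<lambda>t. ereal (dim_ratio t)) \<le> ereal (sigma_plus \<nu>) + ereal e"
    by (simp add: \<sigma>_def)
qed

lemma Liminf_le_Limsup_dim_ratio:
  "Liminf (at_right 0) (\<lambda>t. ereal (dim_ratio t)) \<le> Limsup (at_right 0) (\<lambda>t. ereal (dim_ratio t))"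
  by (rule Liminf_le_Limsup) simp

end

theorem theorem2p1:
  fixes \<nu> :: "(real^'n) measure" and a C :: real
  assumes "prob_space \<nu>" and "sets \<nu> = sets borel"
    and "msupport \<nu> \<subseteq> interior (cbox 0 1)"
    and "a > 0" and "C \<ge> 1"
    and "\<And>k Q. Q \<in> dyadic_cubes k \<Longrightarrow> measure \<nu> Q \<le> C * 2 powr (- a * real k)"
  shows "lower_quant_dim0 \<nu> =
           Liminf (at_right 0) (\<lambda>t. ereal (log 2 (1 / t) / stopping_length \<nu> t)) \<and>
         upper_quant_dim0 \<nu> =
           Limsup (at_right 0) (\<lambda>t. ereal (log 2 (1 / t) / stopping_length \<nu> t)) \<and>
         lower_quant_dim0 \<nu> \<in> {ereal (sigma_minus \<nu>)..ereal (sigma_plus \<nu>)} \<and>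
         upper_quant_dim0 \<nu> \<in> {ereal (sigma_minus \<nu>)..ereal (sigma_plus \<nu>)} \<and>
         (\<forall>c>0. let t = (\<lambda>N. real N powr (- c)) in
           lower_quant_dim0 \<nu> = liminf (\<lambda>N. ereal (log 2 (1 / t N) / stopping_length \<nu> (t N))) \<and>
           upper_quant_dim0 \<nu> = limsup (\<lambda>N. ereal (log 2 (1 / t N) / stopping_length \<nu> (t N))))"
proof -
  interpret prob_space \<nu> by fact
  interpret dyadic_decay \<nu> a C
  proof
    \<comment> \<open>The support condition enters as almost sure membership in the closed unit
      cube.\<close>
    have "msupport \<nu> \<subseteq> cbox 0 1" using assms(3) interior_subset by (rule order_trans)
    then show "AE x in \<nu>. x \<in> cbox 0 1"
      using AE_mem_msupport[OF assms(2)] by (auto elim!: eventually_mono)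
  qed (use assms in auto)
  have "lower_quant_dim0 \<nu> \<le> upper_quant_dim0 \<nu>"
    by (simp add: lower_quant_dim0_eq upper_quant_dim0_eq Liminf_le_Limsup_dim_ratio)
  then have "lower_quant_dim0 \<nu> \<in> {ereal (sigma_minus \<nu>)..ereal (sigma_plus \<nu>)}"
    "upper_quant_dim0 \<nu> \<in> {ereal (sigma_minus \<nu>)..ereal (sigma_plus \<nu>)}"
    using sigma_minus_le_Liminf Limsup_le_sigma_plus
    unfolding lower_quant_dim0_eq[symmetric] upper_quant_dim0_eq[symmetric] by auto
  then show ?thesis
    using lower_quant_dim0_eq upper_quant_dim0_eq liminf_dim_ratio_powr limsup_dim_ratio_powr
    by (simp add: dim_ratio_def Let_def)
qed

end
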